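(* For $\varepsilon>0$ let $\widetilde P^\varepsilon$ be the law on $C(\mathbb R_+,C)$ of the process $(W_t)_{t\ge0}=((|X_t|^2,|X_t|_{-1}^2))_{t\ge0}$ under $\widetilde{\mathbb P}^\varepsilon$. Then the family $\{\widetilde P^\varepsilon:\varepsilon>0\}$ is tight.
   Context: Let $n\ge4$, $N=2n$, and let $1=\lambda_1=\lambda_2<\lambda_3=\lambda_4<\dots<\lambda_{N-1}=\lambda_N$ be reals. On $\mathbb R^N$ put $\langle x,y\rangle=\sum_\ell x_\ell y_\ell$, $|x|^2=\sum_\ell x_\ell^2$, $\langle x,y\rangle_{-1}=\sum_\ell x_\ell y_\ell/\lambda_\ell$, $|x|_{-1}^2=\sum_\ell x_\ell^2/\lambda_\ell$. Fix $a>0$, $\delta_1,\dots,\delta_N\in(-1,0]$ with $\delta_{2i}=\delta_{2i-1}$, and $\widetilde L=\sum_\ell\lambda_\ell(\tfrac a2(1+\delta_\ell)\partial_\ell^2-x_\ell\partial_\ell)$. Let $b:\mathbb R^N\to\mathbb R^N$ with each $b(x)_\ell$ a quadratic form in $x$, $\operatorname{div}b=0$, $\langle x,b(x)\rangle=0=\langle x,b(x)\rangle_{-1}$; $B=\sum_\ell b(x)_\ell\partial_\ell$. Let $\mathcal J$ be the set of triples $J=(k,\ell,m)$ in $\{1,\dots,N\}$ with $\lambda_k<\lambda_\ell<\lambda_m$; $T_J=\sum x_ax_b(1/\lambda_a-1/\lambda_b)\partial_c$ (sum over the three cyclic permutations $(a,b,c)$ of $J$); $R_i=x_{2i}\partial_{2i-1}-x_{2i-1}\partial_{2i}$,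 $1\le i\le n$; enumerate these as $Z_1,\dots,Z_M$ and set $\mathcal D=\frac12\sum_m Z_m^2$. Fix $\kappa\in(0,1]$; for $\varepsilon>0$, $\widetilde{\mathcal L}^\varepsilon=\widetilde L+\varepsilon^{-1}(B+\kappa\mathcal D)$. It is known that the martingale problem for $\widetilde{\mathcal L}^\varepsilon$ on $C(\mathbb R_+,\mathbb R^N)$ (canonical process $(X_t)$) is well posed from every starting point $x$, giving laws $\widetilde{\mathbb P}^\varepsilon_x$ that form a strong Markov process with a unique stationary probability $\widetilde\mu_\varepsilon$; $\widetilde{\mathbb P}^\varepsilon=\int\widetilde\mu_\varepsilon(dx)\widetilde{\mathbb P}^\varepsilon_x$. $C=\{(u,v)\in\mathbb R^2:0\le v\le u\le\lambda_Nv\}$, and $C(\mathbb R_+,C)$ carries the topology of uniform convergence on compact intervals. *)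

theory Defs
  imports "HOL-Analysis.Analysis" "HOL-Probability.Probability"
begin

text \<open>Points of R^N, N = 2n, are represented as functions nat => real whose
  coordinates outside {1..2n} vanish (the set Estate n).\<close>

definition Estate :: "nat \<Rightarrow> (nat \<Rightarrow> real) set" where
  "Estate n = {x. \<forall>l. l \<notin> {1..2*n} \<longrightarrow> x l = 0}"

definition sqnorm :: "nat \<Rightarrow> (nat \<Rightarrow> real) \<Rightarrow> real" where
  "sqnorm n x = (\<Sum>l\<in>{1..2*n}. (x l)^2)"

definition sqnorm_m1 :: "nat \<Rightarrow> (nat \<Rightarrow> real) \<Rightarrow> (nat \<Rightarrow> real) \<Rightarrow> real" where
  "sqnorm_m1 n lam x = (\<Sum>l\<in>{1..2*n}. (x l)^2 / lam l)"

definition inner0 :: "nat \<Rightarrow> (nat \<Rightarrow> real) \<Rightarrow> (nat \<Rightarrow> real) \<Rightarrow> real" where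
  "inner0 n x y = (\<Sum>l\<in>{1..2*n}. x l * y l)"

definition inner_m1 :: "nat \<Rightarrow> (nat \<Rightarrow> real) \<Rightarrow> (nat \<Rightarrow> real) \<Rightarrow> (nat \<Rightarrow> real) \<Rightarrow> real" where
  "inner_m1 n lam x y = (\<Sum>l\<in>{1..2*n}. x l * y l / lam l)"

definition pd :: "nat \<Rightarrow> ((nat \<Rightarrow> real) \<Rightarrow> real) \<Rightarrow> (nat \<Rightarrow> real) \<Rightarrow> real" where
  "pd l f x = deriv (\<lambda>t. f (x(l := x l + t))) 0"

definition has_pd :: "nat \<Rightarrow> ((nat \<Rightarrow> real) \<Rightarrow> real) \<Rightarrow> (nat \<Rightarrow> real) \<Rightarrow> bool" where
  "has_pd l f x \<longleftrightarrow> (\<lambda>t. f (x(l := x l + t))) differentiable (at 0)"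

definition testfun :: "nat \<Rightarrow> ((nat \<Rightarrow> real) \<Rightarrow> real) \<Rightarrow> bool" where
  "testfun n f \<longleftrightarrow>
     continuous_on (Estate n) f \<and>
     (\<forall>l\<in>{1..2*n}. \<forall>x\<in>Estate n. has_pd l f x) \<and>
     (\<forall>l\<in>{1..2*n}. continuous_on (Estate n) (pd l f)) \<and>
     (\<forall>l\<in>{1..2*n}. \<forall>m\<in>{1..2*n}. \<forall>x\<in>Estate n. has_pd m (pd l f) x) \<and>
     (\<forall>l\<in>{1..2*n}. \<forall>m\<in>{1..2*n}. continuous_on (Estate n) (pd m (pd l f))) \<and>
     (\<exists>R. \<forall>x\<in>Estate n. sqnorm n x > R \<longrightarrow> f x = 0)"

definition vf :: "nat \<Rightarrow> ((nat \<Rightarrow> real) \<Rightarrow> nat \<Rightarrow> real) \<Rightarrow> ((nat \<Rightarrow> real) \<Rightarrow> real) \<Rightarrow> (nat \<Rightarrow> real) \<Rightarrow> real" where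
  "vf n c f x = (\<Sum>l\<in>{1..2*n}. c x l * pd l f x)"

definition divergence :: "nat \<Rightarrow> ((nat \<Rightarrow> real) \<Rightarrow> nat \<Rightarrow> real) \<Rightarrow> (nat \<Rightarrow> real) \<Rightarrow> real" where
  "divergence n b x = (\<Sum>l\<in>{1..2*n}. pd l (\<lambda>y. b y l) x)"

definition Jset :: "nat \<Rightarrow> (nat \<Rightarrow> real) \<Rightarrow> (nat \<times> nat \<times> nat) set" where
  "Jset n lam = {(k,l,m). k \<in> {1..2*n} \<and> l \<in> {1..2*n} \<and> m \<in> {1..2*n} \<and>
                   lam k < lam l \<and> lam l < lam m}"

definition cyc_term :: "(nat \<Rightarrow> real) \<Rightarrow> nat \<Rightarrow> nat \<Rightarrow> nat \<Rightarrow> (nat \<Rightarrow> real) \<Rightarrow> nat \<Rightarrow> real" where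
  "cyc_term lam a b c x j = (if j = c then x a * x b * (1 / lam a - 1 / lam b) else 0)"

definition Tfield :: "(nat \<Rightarrow> real) \<Rightarrow> nat \<times> nat \<times> nat \<Rightarrow> (nat \<Rightarrow> real) \<Rightarrow> nat \<Rightarrow> real" where
  "Tfield lam J x j = (case J of (k,l,m) \<Rightarrow>
      cyc_term lam k l m x j + cyc_term lam l m k x j + cyc_term lam m k l x j)"

definition Rfield :: "nat \<Rightarrow> (nat \<Rightarrow> real) \<Rightarrow> nat \<Rightarrow> real" where
  "Rfield i x j = (if j = 2*i - 1 then x (2*i) else if j = 2*i then - x (2*i - 1) else 0)"

definition Dop :: "nat \<Rightarrow> (nat \<Rightarrow> real) \<Rightarrow> ((nat \<Rightarrow> real) \<Rightarrow> real) \<Rightarrow> (nat \<Rightarrow> real) \<Rightarrow> real" where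
  "Dop n lam f x = (1/2) * ((\<Sum>J\<in>Jset n lam. vf n (Tfield lam J) (vf n (Tfield lam J) f) x)
                         + (\<Sum>i\<in>{1..n}. vf n (Rfield i) (vf n (Rfield i) f) x))"

definition Ltilde :: "nat \<Rightarrow> (nat \<Rightarrow> real) \<Rightarrow> real \<Rightarrow> (nat \<Rightarrow> real) \<Rightarrow> ((nat \<Rightarrow> real) \<Rightarrow> real) \<Rightarrow> (nat \<Rightarrow> real) \<Rightarrow> real" where
  "Ltilde n lam a \<delta> f x = (\<Sum>l\<in>{1..2*n}.
      lam l * (a / 2 * (1 + \<delta> l) * pd l (pd l f) x - x l * pd l f x))"

definition Lgen :: "nat \<Rightarrow> (nat \<Rightarrow> real) \<Rightarrow> real \<Rightarrow> (nat \<Rightarrow> real) \<Rightarrow> ((nat \<Rightarrow> real) \<Rightarrow> nat \<Rightarrow> real)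
     \<Rightarrow> real \<Rightarrow> real \<Rightarrow> ((nat \<Rightarrow> real) \<Rightarrow> real) \<Rightarrow> (nat \<Rightarrow> real) \<Rightarrow> real" where
  "Lgen n lam a \<delta> b \<kappa> \<epsilon> f x =
     Ltilde n lam a \<delta> f x + (1 / \<epsilon>) * (vf n b f x + \<kappa> * Dop n lam f x)"

text \<open>Path space C(R_+, R^N): continuous paths with values in Estate n,
  extended constantly to negative times; sigma-algebra generated by the
  coordinate maps at times in T.\<close>
definition Paths :: "nat \<Rightarrow> (real \<Rightarrow> nat \<Rightarrow> real) set" where
  "Paths n = {\<omega>. continuous_on UNIV \<omega> \<and> (\<forall>t. \<omega> t \<in> Estate n) \<and> (\<forall>t\<le>0. \<omega> t = \<omega> 0)}"

definition coord_sigma :: "nat \<Rightarrow> real set \<Rightarrow> (real \<Rightarrow> nat \<Rightarrow> real) measure" where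
  "coord_sigma n T = sigma (Paths n)
     {{\<omega> \<in> Paths n. \<omega> s l \<in> A} | s l A. s \<in> T \<and> A \<in> sets borel}"

abbreviation PathSpace :: "nat \<Rightarrow> (real \<Rightarrow> nat \<Rightarrow> real) measure" where
  "PathSpace n \<equiv> coord_sigma n {0..}"

definition mart_fun :: "(((nat \<Rightarrow> real) \<Rightarrow> real) \<Rightarrow> (nat \<Rightarrow> real) \<Rightarrow> real) \<Rightarrow> ((nat \<Rightarrow> real) \<Rightarrow> real)
     \<Rightarrow> real \<Rightarrow> (real \<Rightarrow> nat \<Rightarrow> real) \<Rightarrow> real" where
  "mart_fun L f t \<omega> = f (\<omega> t) - f (\<omega> 0) - interval_lebesgue_integral lborel 0 (ereal t) (\<lambda>r. L f (\<omega> r))"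

definition solves_MP :: "nat \<Rightarrow> (((nat \<Rightarrow> real) \<Rightarrow> real) \<Rightarrow> (nat \<Rightarrow> real) \<Rightarrow> real)
     \<Rightarrow> (real \<Rightarrow> nat \<Rightarrow> real) measure \<Rightarrow> bool" where
  "solves_MP n L P \<longleftrightarrow> prob_space P \<and> sets P = sets (PathSpace n) \<and>
     (\<forall>f. testfun n f \<longrightarrow>
        (\<forall>t\<ge>0. integrable P (mart_fun L f t)) \<and>
        (\<forall>s t. 0 \<le> s \<and> s \<le> t \<longrightarrow> (\<forall>A \<in> sets (coord_sigma n {0..s}).
            set_lebesgue_integral P A (mart_fun L f t) = set_lebesgue_integral P A (mart_fun L f s))))"

definition stationary_solution :: "nat \<Rightarrow> (((nat \<Rightarrow> real) \<Rightarrow> real) \<Rightarrow> (nat \<Rightarrow> real) \<Rightarrow> real)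
     \<Rightarrow> (real \<Rightarrow> nat \<Rightarrow> real) measure \<Rightarrow> bool" where
  "stationary_solution n L P \<longleftrightarrow> solves_MP n L P \<and>
     (\<forall>t\<ge>0. distr P borel (\<lambda>\<omega>. \<omega> t) = distr P borel (\<lambda>\<omega>. \<omega> 0))"

definition Cone :: "nat \<Rightarrow> (nat \<Rightarrow> real) \<Rightarrow> (real \<times> real) set" where
  "Cone n lam = {(u,v). 0 \<le> v \<and> v \<le> u \<and> u \<le> lam (2*n) * v}"

definition CPaths :: "(real \<times> real) set \<Rightarrow> (real \<Rightarrow> real \<times> real) set" where
  "CPaths S = {w. continuous_on UNIV w \<and> (\<forall>t. w t \<in> S) \<and> (\<forall>t\<le>0. w t = w 0)}"

definition luc_topology :: "(real \<Rightarrow> real \<times> real) set \<Rightarrow> (real \<Rightarrow> real \<times> real) topology" where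
  "luc_topology Q = topology_generated_by
     {{v \<in> Q. \<forall>t\<in>{0..T}. dist (v t) (u t) < r} | u T r. u \<in> Q \<and> T > 0 \<and> r > 0}"

definition Wmap :: "nat \<Rightarrow> (nat \<Rightarrow> real) \<Rightarrow> (nat \<Rightarrow> real) \<Rightarrow> real \<times> real" where
  "Wmap n lam x = (sqnorm n x, sqnorm_m1 n lam x)"

end

theory Submission
  imports Defs
begin

text \<open>Let \<open>q\<close> be one of the quadratic forms \<open>|x|\<^sup>2\<close>, \<open>|x|\<^sub>-\<^sub>1\<^sup>2\<close>. The fields \<open>B\<close>, \<open>T\<^sub>J\<close>, \<open>R\<^sub>i\<close> are all tangent to
  the level sets of \<open>q\<close>, so the generator applied to \<open>\<phi> \<circ> q\<close> is \<open>\<phi>'(q) D + \<phi>''(q) G\<close> and does not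
  involve \<open>\<epsilon>\<close>. Stationarity, tested on powers of a truncation of \<open>q\<close>, bounds all moments of
  \<open>q(X\<^sub>t)\<close> uniformly in \<open>\<epsilon>\<close>. Expanding \<open>(q(X\<^sub>t) - q(X\<^sub>s))\<^sup>4\<close> in powers of \<open>q(X\<^sub>t)\<close> with coefficients
  depending on \<open>q(X\<^sub>s)\<close>, the martingale problem bounds its expectation by \<open>C (t - s) powr (3/2)\<close>,
  and Kolmogorov's chaining argument gives tightness.\<close>

section \<open>Generators acting on functions of a quadratic form\<close>

text \<open>The martingale problem speaks only of compactly supported test functions of the current
  state. Neither \<open>q\<close> nor a power of it is one, hence the truncation; its bounds are
  uniform in the level, so that Fatou removes it at the end. A function of both \<open>X_s\<close>
  and \<open>X_t\<close> is reached only through factors measurable at time \<open>s\<close> that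
  multiply test functions of \<open>X_t\<close>. Fourth powers are needed because second moments of
  increments are only of order \<open>t - s\<close>, short of the exponent above 1 that chaining
  requires. Uniformity in \<epsilon> rests on the constants: each is built from \<open>n\<close>,
  \<open>lam\<close>, \<delta>, \<open>a\<close> and the weights of the form alone.\<close>

text \<open>The weights \<open>c l = 1\<close> and \<open>c l = 1 / lam l\<close> give the two
  quadratic forms, so one argument serves both.\<close>

definition wsq :: "nat \<Rightarrow> (nat \<Rightarrow> real) \<Rightarrow> (nat \<Rightarrow> real) \<Rightarrow> real" where
  "wsq n c x = (\<Sum>l\<in>{1..2*n}. c l * (x l)^2)"

text \<open>The value of \<open>Ltilde\<close> on \<open>wsq n c\<close> itself.\<close>

definition wdrift where
  "wdrift n lam a \<delta> c x = (\<Sum>l\<in>{1..2*n}. lam l * (a * (1 + \<delta> l) * c l - 2 * c l * (x l)^2))"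
  for lam \<delta> c x :: "nat \<Rightarrow> real"

text \<open>The factor of \<open>\<phi>''\<close> in \<open>Ltilde\<close>: half the rate of
  quadratic variation of \<open>wsq n c\<close> along the process.\<close>

definition wdiff where
  "wdiff n lam a \<delta> c x = (\<Sum>l\<in>{1..2*n}. 2 * a * lam l * (1 + \<delta> l) * (c l)^2 * (x l)^2)"
  for lam \<delta> c x :: "nat \<Rightarrow> real"

lemma continuous_on_coord [continuous_intros]: "continuous_on A (\<lambda>x::nat \<Rightarrow> real. x l)"
  by (rule continuous_on_subset[OF continuous_on_product_coordinates]) simp

lemma continuous_on_wsq: "continuous_on A (wsq n c)"
  unfolding wsq_def by (intro continuous_intros)

lemma continuous_on_wdrift: "continuous_on A (wdrift n lam a \<delta> c)"
  unfolding wdrift_def by (intro continuous_intros)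

lemma continuous_on_wdiff: "continuous_on A (wdiff n lam a \<delta> c)"
  unfolding wdiff_def by (intro continuous_intros)

lemma wsq_fun_upd:
  assumes "l \<in> {1..2*n}"
  shows "wsq n c (x(l := y)) = wsq n c x + c l * (y^2 - (x l)^2)"
proof -
  have "wsq n c (x(l := y)) = c l * y^2 + (\<Sum>k\<in>{1..2*n} - {l}. c k * (x k)^2)"
    unfolding wsq_def using assms by (subst sum.remove[of _ l]) auto
  moreover have "wsq n c x = c l * (x l)^2 + (\<Sum>k\<in>{1..2*n} - {l}. c k * (x k)^2)"
    unfolding wsq_def using assms by (subst sum.remove[of _ l]) auto
  ultimately show ?thesis by (simp add: algebra_simps)
qed

lemma pd_eqI:
  assumes "((\<lambda>t. f (x(l := x l + t))) has_real_derivative D) (at 0)"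
  shows "pd l f x = D" "has_pd l f x"
  using assms unfolding pd_def has_pd_def
  by (auto intro: DERIV_imp_deriv simp: real_differentiable_def)

lemma wsq_line_deriv:
  assumes "l \<in> {1..2*n}" and "\<And>s. (\<phi> has_real_derivative \<phi>' s) (at s)"
  shows "((\<lambda>t. \<phi> (wsq n c (x(l := x l + t)))) has_real_derivative \<phi>' (wsq n c x) * (2 * c l * x l)) (at 0)"
proof -
  have "((\<lambda>t. wsq n c x + c l * ((x l + t)^2 - (x l)^2)) has_real_derivative 2 * c l * x l) (at 0)"
    by (auto intro!: derivative_eq_intros)
  from DERIV_chain2[OF assms(2) this] show ?thesis
    using assms(1) by (simp add: wsq_fun_upd)
qed

lemma radial_pd:
  assumes "l \<in> {1..2*n}" and "\<And>s. (\<phi> has_real_derivative \<phi>' s) (at s)"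
  shows "pd l (\<lambda>x. \<phi> (wsq n c x)) = (\<lambda>x. \<phi>' (wsq n c x) * (2 * c l * x l))"
    and "has_pd l (\<lambda>x. \<phi> (wsq n c x)) x"
  using pd_eqI[OF wsq_line_deriv[OF assms]] by auto

lemma radial_pd2:
  assumes "l \<in> {1..2*n}" "m \<in> {1..2*n}"
    and "\<And>s. (\<phi> has_real_derivative \<phi>' s) (at s)"
    and "\<And>s. (\<phi>' has_real_derivative \<phi>'' s) (at s)"
  shows "pd m (pd l (\<lambda>x. \<phi> (wsq n c x))) = (\<lambda>x. \<phi>'' (wsq n c x) * (2 * c m * x m) * (2 * c l * x l)
            + \<phi>' (wsq n c x) * (2 * c l * of_bool (l = m)))" (is ?eq)
    and "has_pd m (pd l (\<lambda>x. \<phi> (wsq n c x))) x"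
proof -
  have eq: "((\<lambda>t. \<phi>' (wsq n c (x(m := x m + t))) * (2 * c l * (x(m := x m + t)) l)) has_real_derivative
      \<phi>'' (wsq n c x) * (2 * c m * x m) * (2 * c l * x l)
            + \<phi>' (wsq n c x) * (2 * c l * of_bool (l = m))) (at 0)" for x
  proof -
    have "((\<lambda>t. 2 * c l * (x(m := x m + t)) l) has_real_derivative 2 * c l * of_bool (l = m)) (at 0)"
      by (cases "l = m") (auto intro!: derivative_eq_intros)
    from DERIV_mult[OF wsq_line_deriv[OF assms(2,4), of c x] this] show ?thesis
      by (rule DERIV_cong) (simp add: algebra_simps)
  qed
  show ?eq using pd_eqI(1)[OF eq] by (auto simp: radial_pd[OF assms(1,3)])
  show "has_pd m (pd l (\<lambda>x. \<phi> (wsq n c x))) x"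
    using pd_eqI(2)[OF eq] by (simp add: radial_pd[OF assms(1,3)])
qed

section \<open>Tangency of the fields to the level sets\<close>

text \<open>\<open>Rfield i\<close> rotates the plane of the coordinates \<open>2*i - 1\<close> and
  \<open>2*i\<close>, in which equal weights make the level sets circles.\<close>

lemma Rfield_tangent:
  assumes "i \<in> {1..n}" "c (2*i - 1) = c (2*i)"
  shows "(\<Sum>l\<in>{1..2*n}. Rfield i x l * (2 * c l * x l)) = 0"
proof -
  have "(\<Sum>l\<in>{1..2*n}. Rfield i x l * (2 * c l * x l)) = (\<Sum>l\<in>{2*i-1, 2*i}. Rfield i x l * (2 * c l * x l))"
    using assms(1) by (intro sum.mono_neutral_right) (auto simp: Rfield_def)
  also have "\<dots> = 0"
    using assms by (subst sum.insert) (auto simp: Rfield_def)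
  finally show ?thesis .
qed

text \<open>The three components contribute the common factor \<open>x i * x j * x k\<close> times a
  cyclic sum, which telescopes for constant weights and cancels in pairs for the weights
  \<open>1 / lam l\<close>.\<close>

lemma Tfield_tangent:
  assumes "J \<in> Jset n lam" "c = (\<lambda>_. 1) \<or> c = (\<lambda>l. 1 / lam l)"
  shows "(\<Sum>l\<in>{1..2*n}. Tfield lam J x l * (2 * c l * x l)) = 0"
proof -
  obtain i j k where J: "J = (i,j,k)" and r: "i \<in> {1..2*n}" "j \<in> {1..2*n}" "k \<in> {1..2*n}"
    using assms(1) by (auto simp: Jset_def)
  have one: "(\<Sum>l\<in>{1..2*n}. cyc_term lam p q s x l * (2 * c l * x l))
      = x p * x q * (1 / lam p - 1 / lam q) * (2 * c s * x s)" if "s \<in> {1..2*n}" for p q s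
  proof -
    have "(\<Sum>l\<in>{1..2*n}. cyc_term lam p q s x l * (2 * c l * x l)) =
       (\<Sum>l\<in>{1..2*n}. if l = s then x p * x q * (1 / lam p - 1 / lam q) * (2 * c s * x s) else 0)"
      by (intro sum.cong) (auto simp: cyc_term_def)
    also have "\<dots> = x p * x q * (1 / lam p - 1 / lam q) * (2 * c s * x s)"
      using that by (subst sum.delta) auto
    finally show ?thesis .
  qed
  have "(\<Sum>l\<in>{1..2*n}. Tfield lam J x l * (2 * c l * x l)) =
    x i * x j * x k * 2 * (c k * (1 / lam i - 1 / lam j) + c i * (1 / lam j - 1 / lam k) + c j * (1 / lam k - 1 / lam i))"
    unfolding J Tfield_def prod.case distrib_right sum.distrib one[OF r(1)] one[OF r(2)] one[OF r(3)]
    by (simp add: algebra_simps)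
  also have "c k * (1 / lam i - 1 / lam j) + c i * (1 / lam j - 1 / lam k) + c j * (1 / lam k - 1 / lam i) = 0"
    using assms(2) by (auto simp: algebra_simps)
  finally show ?thesis by simp
qed

lemma vf_zero: "vf n d (\<lambda>x. 0) x = 0"
  by (simp add: vf_def pd_def)

lemma vf_radial:
  assumes "\<And>s. (\<phi> has_real_derivative \<phi>' s) (at s)"
  shows "vf n d (\<lambda>x. \<phi> (wsq n c x)) x = \<phi>' (wsq n c x) * (\<Sum>l\<in>{1..2*n}. d x l * (2 * c l * x l))"
  unfolding vf_def sum_distrib_left
  by (intro sum.cong) (auto simp: radial_pd[OF _ assms])

lemma Ltilde_radial:
  assumes "\<And>s. (\<phi> has_real_derivative \<phi>' s) (at s)"
    and "\<And>s. (\<phi>' has_real_derivative \<phi>'' s) (at s)"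
  shows "Ltilde n lam a \<delta> (\<lambda>x. \<phi> (wsq n c x)) x =
    \<phi>' (wsq n c x) * wdrift n lam a \<delta> c x + \<phi>'' (wsq n c x) * wdiff n lam a \<delta> c x"
  unfolding Ltilde_def wdrift_def wdiff_def sum_distrib_left sum.distrib[symmetric]
proof (intro sum.cong refl)
  fix l assume l: "l \<in> {1..2*n}"
  note e1 = fun_cong[OF radial_pd(1)[OF l assms(1)], of c x]
    and e2 = fun_cong[OF radial_pd2(1)[OF l l assms], of c x]
  show "lam l * (a / 2 * (1 + \<delta> l) * pd l (pd l (\<lambda>x. \<phi> (wsq n c x))) x - x l * pd l (\<lambda>x. \<phi> (wsq n c x)) x) =
    \<phi>' (wsq n c x) * (lam l * (a * (1 + \<delta> l) * c l - 2 * c l * (x l)^2)) +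
    \<phi>'' (wsq n c x) * (2 * a * lam l * (1 + \<delta> l) * (c l)^2 * (x l)^2)"
    unfolding e1 e2 by (simp add: power2_eq_square field_simps)
qed

text \<open>Tangency of \<open>Tfield\<close> and \<open>Rfield\<close> holds at every point, so the
  inner derivative in each squared field is the zero function and the outer one vanishes with it.
  For the first-order field \<open>b\<close>, orthogonality at the single point \<open>x\<close> is
  enough.\<close>

lemma Lgen_radial:
  assumes \<phi>: "\<And>s. (\<phi> has_real_derivative \<phi>' s) (at s)"
    and \<phi>': "\<And>s. (\<phi>' has_real_derivative \<phi>'' s) (at s)"
    and c: "c = (\<lambda>_. 1) \<or> c = (\<lambda>l. 1 / lam l)"
    and lam_pair: "\<forall>i\<in>{1..n}. lam (2*i - 1) = lam (2*i)"
    and b_orth: "inner0 n x (b x) = 0" "inner_m1 n lam x (b x) = 0"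
  shows "Lgen n lam a \<delta> b \<kappa> \<epsilon> (\<lambda>x. \<phi> (wsq n c x)) x =
    \<phi>' (wsq n c x) * wdrift n lam a \<delta> c x + \<phi>'' (wsq n c x) * wdiff n lam a \<delta> c x"
proof -
  have "(\<Sum>l\<in>{1..2*n}. b x l * (2 * c l * x l)) = 2 * (\<Sum>l\<in>{1..2*n}. x l * b x l * c l)"
    unfolding sum_distrib_left by (intro sum.cong) (auto simp: algebra_simps)
  also have "\<dots> = 0" using b_orth c by (auto simp: inner0_def inner_m1_def)
  finally have B: "vf n b (\<lambda>x. \<phi> (wsq n c x)) x = 0" by (simp add: vf_radial[OF \<phi>])
  have T: "vf n (Tfield lam J) (\<lambda>x. \<phi> (wsq n c x)) = (\<lambda>x. 0)" if "J \<in> Jset n lam" for J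
    using Tfield_tangent[OF that c] by (auto simp: vf_radial[OF \<phi>])
  have R: "vf n (Rfield i) (\<lambda>x. \<phi> (wsq n c x)) = (\<lambda>x. 0)" if "i \<in> {1..n}" for i
  proof -
    have "c (2*i - 1) = c (2*i)" using c lam_pair that by auto
    from Rfield_tangent[OF that this] show ?thesis by (auto simp: vf_radial[OF \<phi>])
  qed
  have "Dop n lam (\<lambda>x. \<phi> (wsq n c x)) x = 0"
    unfolding Dop_def by (simp add: T R vf_zero)
  then show ?thesis
    by (simp add: Lgen_def B Ltilde_radial[OF \<phi> \<phi>'])
qed

lemma wsq_nonneg: "(\<And>l. l \<in> {1..2*n} \<Longrightarrow> 0 \<le> c l) \<Longrightarrow> 0 \<le> wsq n c x"
  unfolding wsq_def by (intro sum_nonneg) auto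

text \<open>Compact support comes from positive weights: the smallest of them bounds
  \<open>wsq n c\<close> from below by a multiple of \<open>sqnorm n\<close>.\<close>

lemma testfun_radial:
  assumes \<phi>: "\<And>s. (\<phi> has_real_derivative \<phi>' s) (at s)"
    and \<phi>': "\<And>s. (\<phi>' has_real_derivative \<phi>'' s) (at s)"
    and \<phi>'': "continuous_on UNIV \<phi>''"
    and supp: "\<And>s. s \<ge> R \<Longrightarrow> \<phi> s = 0"
    and c: "\<And>l. l \<in> {1..2*n} \<Longrightarrow> 0 < c l"
  shows "testfun n (\<lambda>x. \<phi> (wsq n c x))"
proof -
  have c0: "continuous_on A (\<lambda>x. \<phi> (wsq n c x))" for A
    by (rule continuous_on_compose2[OF _ continuous_on_wsq, of UNIV])
       (auto intro!: DERIV_continuous_on[OF DERIV_subset[OF \<phi>]])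
  have c1: "continuous_on A (\<lambda>x. \<phi>' (wsq n c x))" for A
    by (rule continuous_on_compose2[OF _ continuous_on_wsq, of UNIV])
       (auto intro!: DERIV_continuous_on[OF DERIV_subset[OF \<phi>']])
  have c2: "continuous_on A (\<lambda>x. \<phi>'' (wsq n c x))" for A
    by (rule continuous_on_compose2[OF \<phi>'' continuous_on_wsq]) auto
  obtain c0' where c0': "c0' > 0" "\<And>l. l \<in> {1..2*n} \<Longrightarrow> c0' \<le> c l"
  proof (cases "n = 0")
    case False
    then have "Min (c ` {1..2*n}) \<in> c ` {1..2*n}" by (intro Min_in) auto
    with c have "0 < Min (c ` {1..2*n})" by auto
    then show ?thesis by (rule that) auto
  qed (auto intro: that[of 1])
  have "\<phi> (wsq n c x) = 0" if "sqnorm n x > R / c0'" for x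
  proof (rule supp)
    have "R \<le> c0' * sqnorm n x" using that c0'(1) by (simp add: field_simps)
    also have "\<dots> \<le> wsq n c x"
      unfolding sqnorm_def wsq_def sum_distrib_left
      by (intro sum_mono mult_right_mono c0'(2)) auto
    finally show "R \<le> wsq n c x" .
  qed
  moreover have "continuous_on (Estate n) (pd l (\<lambda>x. \<phi> (wsq n c x)))" if "l \<in> {1..2*n}" for l
    unfolding radial_pd(1)[OF that \<phi>] by (intro c1 continuous_intros)
  moreover have "continuous_on (Estate n) (pd m (pd l (\<lambda>x. \<phi> (wsq n c x))))"
    if "l \<in> {1..2*n}" "m \<in> {1..2*n}" for l m
    unfolding radial_pd2(1)[OF that \<phi> \<phi>'] by (intro c1 c2 continuous_intros)
  ultimately show ?thesis
    unfolding testfun_def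
    using radial_pd(2)[OF _ \<phi>] radial_pd2(2)[OF _ _ \<phi> \<phi>'] c0 by blast
qed

text \<open>A \<open>C\<^sup>2\<close> truncation of the identity: it is constant beyond \<open>R\<close>, so its powers
  composed with a quadratic form are compactly supported up to a constant.\<close>
definition trunc_id :: "real \<Rightarrow> real \<Rightarrow> real" where
  "trunc_id R s = R / 3 * (1 - (max 0 (1 - s / R))^3)"
definition trunc_id' :: "real \<Rightarrow> real \<Rightarrow> real" where
  "trunc_id' R s = (max 0 (1 - s / R))^2"
definition trunc_id'' :: "real \<Rightarrow> real \<Rightarrow> real" where
  "trunc_id'' R s = - (2 / R) * max 0 (1 - s / R)"

lemma DERIV_pos_part_power:
  "((\<lambda>x::real. (max 0 x)^(k+2)) has_real_derivative (real k + 2) * (max 0 x)^(k+1)) (at x)"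
proof -
  consider "x < 0" | "x > 0" | "x = 0" by linarith
  then show ?thesis
  proof cases
    case 1
    then have "eventually (\<lambda>y. (max 0 y)^(k+2) = 0) (nhds x)"
      using eventually_nhds_in_open[of "{..<0}" x] by (auto elim!: eventually_mono)
    moreover have "((\<lambda>x. 0) has_real_derivative (real k + 2) * (max 0 x)^(k+1)) (at x)"
      using 1 by simp
    ultimately show ?thesis by (subst DERIV_cong_ev[OF refl _ refl, where g = "\<lambda>x. 0"]) auto
  next
    case 2
    then have "eventually (\<lambda>y. (max 0 y)^(k+2) = y^(k+2)) (nhds x)"
      using eventually_nhds_in_open[of "{0<..}" x] by (auto elim!: eventually_mono simp: max_def)
    moreover have "((\<lambda>x. x^(k+2)) has_real_derivative (real k + 2) * (max 0 x)^(k+1)) (at x)"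
      using 2 by (intro DERIV_cong[OF DERIV_pow]) (simp add: max_def)
    ultimately show ?thesis by (subst DERIV_cong_ev[OF refl _ refl, where g = "\<lambda>x. x^(k+2)"]) auto
  next
    case 3
    \<comment> \<open>At the origin the difference quotient is \<open>(max 0 h)^(k+1)\<close>
      itself, which tends to 0 because the exponent is positive.\<close>
    have "((\<lambda>h::real. (max 0 h)^(k+1)) \<longlongrightarrow> (max 0 0)^(k+1)) (at 0)"
      by (intro tendsto_intros)
    then have "((\<lambda>h::real. (max 0 h)^(k+1)) \<longlongrightarrow> 0) (at 0)" by simp
    moreover have "(max 0 h)^(k+1) = ((max 0 h)^(k+2) - (max 0 0)^(k+2)) / (h - 0)" if "h \<noteq> 0" for h :: real
      using that by (cases "h > 0") (auto simp: max_def)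
    ultimately have "((\<lambda>h::real. ((max 0 h)^(k+2) - (max 0 0)^(k+2)) / (h - 0)) \<longlongrightarrow> 0) (at 0)"
      by (auto intro: Lim_transform_eventually simp: eventually_at_filter)
    then show ?thesis using 3 by (simp add: has_field_derivative_iff)
  qed
qed

lemma DERIV_trunc_id:
  assumes "R > 0" shows "(trunc_id R has_real_derivative trunc_id' R s) (at s)"
proof -
  have "((\<lambda>s. 1 - s / R) has_real_derivative - 1 / R) (at s)"
    using assms by (auto intro!: derivative_eq_intros)
  from DERIV_chain2[OF DERIV_pos_part_power[of 1] this]
  have "((\<lambda>s. (max 0 (1 - s / R))^3) has_real_derivative - (3 / R) * (max 0 (1 - s / R))^2) (at s)"
    by (simp add: numeral_3_eq_3 numeral_2_eq_2)
  from DERIV_cmult[OF DERIV_diff[OF DERIV_const this], of "R / 3" 1]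
  have "((\<lambda>s. R / 3 * (1 - (max 0 (1 - s / R))^3)) has_real_derivative (max 0 (1 - s / R))^2) (at s)"
    by (rule DERIV_cong) (use assms in simp)
  moreover have "trunc_id R = (\<lambda>s. R / 3 * (1 - (max 0 (1 - s / R))^3))"
    by (simp add: fun_eq_iff trunc_id_def)
  ultimately show ?thesis by (simp add: trunc_id'_def)
qed

lemma DERIV_trunc_id':
  assumes "R > 0" shows "(trunc_id' R has_real_derivative trunc_id'' R s) (at s)"
proof -
  have "((\<lambda>s. 1 - s / R) has_real_derivative - 1 / R) (at s)"
    using assms by (auto intro!: derivative_eq_intros)
  from DERIV_chain2[OF DERIV_pos_part_power[of 0] this]
  have "((\<lambda>s. (max 0 (1 - s / R))^2) has_real_derivative - (2 / R) * max 0 (1 - s / R)) (at s)"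
    by (simp add: numeral_2_eq_2)
  moreover have "trunc_id' R = (\<lambda>s. (max 0 (1 - s / R))^2)"
    by (simp add: fun_eq_iff trunc_id'_def)
  ultimately show ?thesis by (simp add: trunc_id''_def)
qed

lemma trunc_id_ge: "R > 0 \<Longrightarrow> s \<ge> R \<Longrightarrow> trunc_id R s = R / 3"
  by (simp add: trunc_id_def max_def field_simps)
lemma trunc_id'_ge: "R > 0 \<Longrightarrow> s \<ge> R \<Longrightarrow> trunc_id' R s = 0"
  by (simp add: trunc_id'_def max_def field_simps)
lemma trunc_id''_ge: "R > 0 \<Longrightarrow> s \<ge> R \<Longrightarrow> trunc_id'' R s = 0"
  by (simp add: trunc_id''_def max_def field_simps)

text \<open>On the half line the truncation is increasing and concave with slope at most 1.
  Concavity lets the second-derivative term be dropped in the moment bound; the bound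
  \<open>2 / R\<close> keeps that term under control, uniformly in \<open>R \<ge> 1\<close>, in the
  increment bound.\<close>

lemma trunc_id_bounds:
  assumes "R > 0" "s \<ge> 0"
  shows "0 \<le> trunc_id R s" "trunc_id R s \<le> s" "trunc_id R s \<le> R"
    "0 \<le> trunc_id' R s" "trunc_id' R s \<le> 1" "trunc_id'' R s \<le> 0" "\<bar>trunc_id'' R s\<bar> \<le> 2 / R"
proof -
  let ?y = "max 0 (1 - s / R)"
  have y: "0 \<le> ?y" "?y \<le> 1" using assms by auto
  have y3: "?y^3 \<le> 1" "?y^2 \<le> 1" using y by (auto intro: power_le_one)
  show "0 \<le> trunc_id R s" using assms y3 by (simp add: trunc_id_def)
  have "trunc_id R s \<le> R / 3 * 1" unfolding trunc_id_def using assms y by (intro mult_left_mono) auto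
  then show "trunc_id R s \<le> R" using assms by simp
  show "trunc_id' R s \<le> 1" "0 \<le> trunc_id' R s" using y3 by (auto simp: trunc_id'_def)
  show "trunc_id'' R s \<le> 0" using assms y by (simp add: trunc_id''_def divide_nonpos_pos mult_nonneg_nonneg)
  have "\<bar>trunc_id'' R s\<bar> = 2 / R * ?y" using assms y by (simp add: trunc_id''_def abs_mult)
  also have "\<dots> \<le> 2 / R * 1" using assms y by (intro mult_left_mono) auto
  finally show "\<bar>trunc_id'' R s\<bar> \<le> 2 / R" by simp
  have "1 - ?y^3 \<le> 3 * (1 - ?y)"
  proof -
    have "3 * (1 - ?y) - (1 - ?y^3) = (1 - ?y)^2 * (2 + ?y)" by (simp add: power2_eq_square power3_eq_cube algebra_simps)
    also have "\<dots> \<ge> 0" using y by auto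
    finally show ?thesis by simp
  qed
  also have "\<dots> \<le> 3 * (s / R)" using max.cobounded2[of "1 - s / R" 0]
    by (simp only: mult_le_cancel_left_pos zero_less_numeral diff_le_eq add.commute)
  finally have "R / 3 * (1 - ?y^3) \<le> R / 3 * (3 * (s / R))" using assms by (intro mult_left_mono) auto
  then show "trunc_id R s \<le> s" using assms by (simp add: trunc_id_def)
qed

lemma trunc_id_tendsto:
  "(\<lambda>k. trunc_id (real (Suc k)) s) \<longlonglongrightarrow> s" "(\<lambda>k. trunc_id' (real (Suc k)) s) \<longlonglongrightarrow> 1"
proof -
  have 0: "(\<lambda>k. s / real (Suc k)) \<longlonglongrightarrow> 0" using lim_const_over_n[of s] by (rule LIMSEQ_Suc)
  have "(\<lambda>k. (max 0 (1 - s / real (Suc k)))^2) \<longlonglongrightarrow> (max 0 (1 - 0))^2"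
    by (intro tendsto_intros 0)
  then show "(\<lambda>k. trunc_id' (real (Suc k)) s) \<longlonglongrightarrow> 1" by (simp add: trunc_id'_def)
  \<comment> \<open>This polynomial is the truncation at level \<open>R = real (Suc k)\<close>,
    expanded for \<open>s \<le> R\<close>.\<close>
  have "(\<lambda>k. s - s * (s / real (Suc k)) + s / 3 * (s / real (Suc k))^2) \<longlonglongrightarrow> s - s * 0 + s / 3 * 0^2"
    by (intro tendsto_intros 0)
  then have "(\<lambda>k. s - s * (s / real (Suc k)) + s / 3 * (s / real (Suc k))^2) \<longlonglongrightarrow> s" by simp
  moreover have "\<forall>\<^sub>F k in sequentially. s - s * (s / real (Suc k)) + s / 3 * (s / real (Suc k))^2 = trunc_id (real (Suc k)) s"
  proof -
    obtain N :: nat where "s < N" using reals_Archimedean2 by blast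
    then have "s - s * (s / real (Suc k)) + s / 3 * (s / real (Suc k))^2 = trunc_id (real (Suc k)) s" if "k \<ge> N" for k
    proof -
      define R where "R = real (Suc k)"
      have R: "R > 0" "s \<le> R" using \<open>s < N\<close> that by (auto simp: R_def)
      then have max: "max 0 (1 - s / R) = 1 - s / R" by (simp add: max_def field_simps)
      show ?thesis unfolding R_def[symmetric] trunc_id_def max using R(1)
        by (simp add: field_simps power2_eq_square power3_eq_cube)
    qed
    then show ?thesis by (auto simp: eventually_sequentially)
  qed
  ultimately show "(\<lambda>k. trunc_id (real (Suc k)) s) \<longlonglongrightarrow> s" by (rule Lim_transform_eventually)
qed

section \<open>A Kolmogorov tightness criterion\<close>

text \<open>Any ratio \<open>r < 1\<close> with \<open>r\<^sup>4 > 2 powr (- 1/2)\<close> could replace 19/20.\<close>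
definition dyad_good :: "nat \<Rightarrow> (real \<Rightarrow> 'a::real_normed_vector) \<Rightarrow> bool" where
  "dyad_good k0 w \<longleftrightarrow> (\<forall>k\<ge>k0. \<forall>j\<le>k * 2^k. norm (w (real j / 2^k)) \<le> 4^k \<and>
     dist (w (real (Suc j) / 2^k)) (w (real j / 2^k)) \<le> (19/20)^k)"

definition dyad :: "nat \<Rightarrow> real \<Rightarrow> nat" where
  "dyad k t = nat \<lfloor>2^k * t\<rfloor>"

lemma dyad:
  assumes "0 \<le> t"
  shows "real (dyad k t) \<le> 2^k * t" "2^k * t < real (dyad k t) + 1"
proof -
  have "0 \<le> \<lfloor>2^k * t\<rfloor>" using assms by simp
  then have "real (dyad k t) = real_of_int \<lfloor>2^k * t\<rfloor>" by (simp add: dyad_def)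
  then show "real (dyad k t) \<le> 2^k * t" "2^k * t < real (dyad k t) + 1" by linarith+
qed

lemma dyad_div:
  assumes "0 \<le> t"
  shows "real (dyad k t) / 2^k \<le> t" "t \<le> real (dyad k t) / 2^k + 1 / 2^k"
proof -
  show "real (dyad k t) / 2^k \<le> t"
    using dyad(1)[OF assms, of k] by (simp add: pos_divide_le_eq mult.commute)
  have "t \<le> (real (dyad k t) + 1) / 2^k"
    using dyad(2)[OF assms, of k] by (simp add: pos_le_divide_eq mult.commute)
  then show "t \<le> real (dyad k t) / 2^k + 1 / 2^k" by (simp add: add_divide_distrib)
qed

lemma dyad_le:
  assumes "0 \<le> t" "t \<le> real m" "m \<le> k"
  shows "dyad k t \<le> k * 2^k"
proof -
  have "real (dyad k t) \<le> 2^k * t" using dyad(1)[OF assms(1)] .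
  also have "\<dots> \<le> 2^k * real k" using assms by (intro mult_left_mono) auto
  finally have "real (dyad k t) \<le> real (k * 2^k)" by (simp add: mult.commute)
  then show ?thesis by (simp only: of_nat_le_iff)
qed

lemma dyad_Suc: "0 \<le> t \<Longrightarrow> dyad (Suc k) t = 2 * dyad k t \<or> dyad (Suc k) t = Suc (2 * dyad k t)"
proof -
  assume t: "0 \<le> t"
  have "real (dyad (Suc k) t) < real (2 * dyad k t + 2)" "real (2 * dyad k t) < real (dyad (Suc k) t + 1)"
    using dyad[OF t, of k] dyad[OF t, of "Suc k"] by (simp_all add: mult.assoc)
  then show ?thesis by (simp only: of_nat_less_iff) arith
qed

text \<open>\<open>t\<close> is the limit of its dyadic floors, and consecutive floors coincide or
  are neighbours at the finer level. The jumps from level \<open>m + 1\<close> on form a geometric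
  series with sum \<open>19 * (19/20)^m\<close>; continuity of \<open>w\<close> carries the bound to
  \<open>t\<close>.\<close>

lemma dyad_chain:
  assumes w: "continuous_on UNIV w" "dyad_good k0 w" and m: "k0 \<le> m" and t: "0 \<le> t" "t \<le> real m"
  shows "dist (w t) (w (real (dyad m t) / 2^m)) \<le> 19 * (19/20)^m"
proof -
  let ?d = "\<lambda>k. real (dyad k t) / 2^k"
  have step: "dist (w (?d (Suc k))) (w (?d k)) \<le> (19/20)^Suc k" if "m \<le> k" for k
  proof -
    have 2: "?d k = real (2 * dyad k t) / 2^Suc k" by simp
    \<comment> \<open>Doubling the index keeps it below \<open>Suc k * 2^Suc k\<close>, the range in
      which \<open>dyad_good\<close> controls neighbours.\<close>
    have le: "2 * dyad k t \<le> Suc k * 2^Suc k"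
      using dyad_le[OF t that] by simp
    show ?thesis
    proof (cases "dyad (Suc k) t = 2 * dyad k t")
      case True
      then show ?thesis unfolding 2 by simp
    next
      case False
      then have e: "dyad (Suc k) t = Suc (2 * dyad k t)" using dyad_Suc[OF t(1), of k] by simp
      have "Suc k \<ge> k0" using that m by simp
      then show ?thesis unfolding 2 e using w(2) le unfolding dyad_good_def by blast
    qed
  qed
  have ind: "dist (w (?d (m + i))) (w (?d m)) \<le> 19 * ((19/20)^m - (19/20)^(m + i))" for i
  proof (induction i)
    case (Suc i)
    have "dist (w (?d (m + Suc i))) (w (?d m)) \<le> dist (w (?d (Suc (m + i)))) (w (?d (m + i))) + dist (w (?d (m + i))) (w (?d m))"
      using dist_triangle by simp
    also have "\<dots> \<le> (19/20)^Suc (m + i) + 19 * ((19/20)^m - (19/20)^(m + i))"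
      using step[of "m + i"] Suc by (intro add_mono) auto
    also have "\<dots> = 19 * ((19/20)^m - (19/20)^(m + Suc i))" by (simp add: field_simps)
    finally show ?case .
  qed simp
  have lim: "(\<lambda>i. ?d (m + i)) \<longlonglongrightarrow> t"
  proof (rule real_tendsto_sandwich)
    show "\<forall>\<^sub>F i in sequentially. t - (1/2)^(m + i) \<le> ?d (m + i)"
      using dyad_div(2)[OF t(1)] by (intro always_eventually allI) (simp add: diff_le_eq power_one_over)
    show "\<forall>\<^sub>F i in sequentially. ?d (m + i) \<le> t"
      using dyad_div(1)[OF t(1)] by (intro always_eventually allI)
    have "(\<lambda>i. t - (1/2)^m * (1/2)^i) \<longlonglongrightarrow> t - (1/2)^m * 0"
      by (intro tendsto_intros LIMSEQ_power_zero) simp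
    then show "(\<lambda>i. t - (1/2)^(m + i)) \<longlonglongrightarrow> t" by (simp add: power_add)
  qed simp
  have "isCont w t" using w(1) by (simp add: continuous_on_eq_continuous_at)
  then have "(\<lambda>i. dist (w (?d (m + i))) (w (?d m))) \<longlonglongrightarrow> dist (w t) (w (?d m))"
    by (intro tendsto_intros isCont_tendsto_compose[OF _ lim])
  moreover have "dist (w (?d (m + i))) (w (?d m)) \<le> 19 * (19/20)^m" for i
  proof -
    have "0 \<le> (19/20::real)^(m + i)" by (rule zero_le_power) simp
    then show ?thesis using ind[of i] unfolding right_diff_distrib by linarith
  qed
  ultimately show ?thesis by (intro LIMSEQ_le_const2) auto
qed

text \<open>Points at distance at most \<open>1 / 2^m\<close> have equal or neighbouring floors at
  level \<open>m\<close>, whence \<open>39 = 19 + 1 + 19\<close>: two chains and one dyadic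
  step.\<close>

lemma dyad_modulus:
  assumes w: "continuous_on UNIV w" "dyad_good k0 w" and m: "k0 \<le> m"
    and s: "0 \<le> s" "s \<le> real m" and t: "0 \<le> t" "t \<le> real m" and st: "\<bar>s - t\<bar> \<le> 1 / 2^m"
  shows "dist (w s) (w t) \<le> 39 * (19/20)^m"
  using s t st
proof (induction s t rule: linorder_wlog)
  case (le s t)
  let ?s = "dyad m s" and ?t = "dyad m t"
  have "2^m * s \<le> 2^m * t" "2^m * t \<le> 2^m * s + 1"
    using le by (auto simp: field_simps)
  then have "real ?s < real (?t + 1)" "real ?t < real (?s + 2)"
    using dyad[of s m] dyad[of t m] le unfolding of_nat_add of_nat_1 of_nat_numeral by linarith+
  then have "?t = ?s \<or> ?t = Suc ?s" by (simp only: of_nat_less_iff) arith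
  moreover have "dist (w (real (Suc ?s) / 2^m)) (w (real ?s / 2^m)) \<le> (19/20)^m"
    using w(2) m dyad_le[of s m m] le unfolding dyad_good_def by blast
  ultimately have 1: "dist (w (real ?t / 2^m)) (w (real ?s / 2^m)) \<le> (19/20)^m" by auto
  have 2: "dist (w s) (w (real ?s / 2^m)) \<le> 19 * (19/20)^m" "dist (w t) (w (real ?t / 2^m)) \<le> 19 * (19/20)^m"
    using dyad_chain[OF w m] le by auto
  have "dist (w s) (w t) \<le> dist (w s) (w (real ?s / 2^m)) + (dist (w (real ?s / 2^m)) (w (real ?t / 2^m)) + dist (w (real ?t / 2^m)) (w t))"
    by (meson add_left_mono dist_triangle order_trans)
  then show ?case using 1 2 by (simp add: dist_commute)
next
  case (sym s t)
  then show ?case by (simp add: dist_commute abs_minus_commute)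
qed

lemma dyad_norm:
  assumes w: "continuous_on UNIV w" "dyad_good k0 w" and m: "k0 \<le> m" and t: "0 \<le> t" "t \<le> real m"
  shows "norm (w t) \<le> 4^m + 19"
proof -
  let ?d = "real (dyad m t) / 2^m"
  have "norm (w t) \<le> norm (w ?d) + dist (w t) (w ?d)"
    by (metis add.commute dist_norm norm_triangle_sub)
  moreover have "norm (w ?d) \<le> 4^m"
    using w(2) m dyad_le[OF t order_refl] unfolding dyad_good_def by blast
  moreover have "dist (w t) (w ?d) \<le> 19 * (19/20)^m" by (rule dyad_chain[OF w m t])
  moreover have "(19/20::real)^m \<le> 1" by (intro power_le_one) auto
  ultimately show ?thesis by linarith
qed

text \<open>For continuous paths the last two conditions follow from the dyadic ones; they force continuity
  of pointwise limits, while the dyadic ones make membership a countable, hence measurable,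
  condition.\<close>
definition mod_set :: "nat \<Rightarrow> 'a set \<Rightarrow> (real \<Rightarrow> 'a::real_normed_vector) set" where
  "mod_set k0 S = {w. (\<forall>t. w t \<in> S) \<and> (\<forall>t. t \<le> 0 \<longrightarrow> w t = w 0) \<and>
     (\<forall>k j. k0 \<le> k \<and> j \<le> k * 2^k \<longrightarrow> norm (w (real j / 2^k)) \<le> 4^k) \<and>
     (\<forall>k j. k0 \<le> k \<and> j \<le> k * 2^k \<longrightarrow> dist (w (real (Suc j) / 2^k)) (w (real j / 2^k)) \<le> (19/20)^k) \<and>
     (\<forall>m s t. k0 \<le> m \<and> 0 \<le> s \<and> s \<le> real m \<and> 0 \<le> t \<and> t \<le> real m \<and> \<bar>s - t\<bar> \<le> 1 / 2^m \<longrightarrow>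
         dist (w s) (w t) \<le> 39 * (19/20)^m) \<and>
     (\<forall>m t. k0 \<le> m \<and> 0 \<le> t \<and> t \<le> real m \<longrightarrow> norm (w t) \<le> 4^m + 19)}"

lemma mod_set_iff:
  assumes "w \<in> CPaths S" shows "w \<in> mod_set k0 S \<longleftrightarrow> dyad_good k0 w"
proof
  assume "w \<in> mod_set k0 S" then show "dyad_good k0 w" unfolding mod_set_def dyad_good_def by blast
next
  assume g: "dyad_good k0 w"
  have w: "continuous_on UNIV w" "\<forall>t. w t \<in> S" "\<forall>t. t \<le> 0 \<longrightarrow> w t = w 0"
    using assms unfolding CPaths_def by blast+
  show "w \<in> mod_set k0 S"
    unfolding mod_set_def mem_Collect_eq
    by (intro conjI w(2,3) allI impI; (elim conjE)?)
       ((rule dyad_modulus[OF w(1) g]; assumption) | (rule dyad_norm[OF w(1) g]; assumption) | (use g in \<open>unfold dyad_good_def, blast\<close>))+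
qed

lemma mod_setD:
  assumes "w \<in> mod_set k0 S"
  shows "w t \<in> S" "t \<le> 0 \<Longrightarrow> w t = w 0"
    "\<And>m s t. k0 \<le> m \<Longrightarrow> 0 \<le> s \<Longrightarrow> s \<le> real m \<Longrightarrow> 0 \<le> t \<Longrightarrow> t \<le> real m \<Longrightarrow> \<bar>s - t\<bar> \<le> 1 / 2^m \<Longrightarrow> dist (w s) (w t) \<le> 39 * (19/20)^m"
    "\<And>m t. k0 \<le> m \<Longrightarrow> 0 \<le> t \<Longrightarrow> t \<le> real m \<Longrightarrow> norm (w t) \<le> 4^m + 19"
  using assms unfolding mod_set_def by blast+

lemma small_level:
  assumes "e > 0" obtains m :: nat where "k0 \<le> m" "T \<le> real m" "39 * (19/20)^m < (e::real)"
proof -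
  have "(\<lambda>m. 39 * (19/20::real)^m) \<longlonglongrightarrow> 39 * 0" by (intro tendsto_intros LIMSEQ_power_zero) simp
  then have "\<forall>\<^sub>F m in sequentially. 39 * (19/20::real)^m < e" using assms by (intro order_tendstoD(2)) auto
  moreover have "\<forall>\<^sub>F m in sequentially. k0 \<le> m" by (rule eventually_ge_at_top)
  moreover have "\<forall>\<^sub>F m in sequentially. T \<le> real m"
    using filterlim_real_sequentially by (simp add: filterlim_at_top)
  ultimately have "\<forall>\<^sub>F m in sequentially. k0 \<le> m \<and> T \<le> real m \<and> 39 * (19/20::real)^m < e"
    by eventually_elim auto
  then show ?thesis using that by (auto simp: eventually_sequentially)
qed

lemma mod_set_subset: "mod_set k0 S \<subseteq> CPaths S"
proof
  fix w assume w: "w \<in> mod_set k0 S"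
  have "continuous_on UNIV w"
    unfolding continuous_on_iff
  proof (intro ballI allI impI)
    fix x e :: real assume e: "e > 0"
    obtain m where m: "k0 \<le> m" "\<bar>x\<bar> + 1 \<le> real m" "39 * (19/20)^m < e"
      by (rule small_level[OF e, of k0 "\<bar>x\<bar> + 1"])
    show "\<exists>d>0. \<forall>y\<in>UNIV. dist y x < d \<longrightarrow> dist (w y) (w x) < e"
    proof (intro exI conjI ballI impI)
      show "0 < (1::real) / 2^m" by simp
      fix y assume y: "dist y x < 1 / 2^m"
      have "(1::real) / 2^m \<le> 1" by simp
      then have "\<bar>y\<bar> \<le> real m" using y m unfolding dist_real_def by linarith
      \<comment> \<open>\<open>max 0\<close> does not increase distances and \<open>w\<close> is
        constant on negative times, so the modulus known on nonnegative times gives continuity on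
        the whole line.\<close>
      moreover have "\<bar>max 0 y - max 0 x\<bar> \<le> 1 / 2^m" using y by (auto simp: dist_real_def max_def)
      ultimately have "dist (w (max 0 y)) (w (max 0 x)) \<le> 39 * (19/20)^m"
        using m by (intro mod_setD(3)[OF w]) auto
      moreover have "w (max 0 z) = w z" for z
        by (cases "z \<le> 0") (use mod_setD(2)[OF w, of z] in \<open>auto simp: max_def\<close>)
      ultimately show "dist (w y) (w x) < e" using m by simp
    qed
  qed
  then show "w \<in> CPaths S" using mod_setD(1,2)[OF w] unfolding CPaths_def by blast
qed

section \<open>Compactness, pointwise and locally uniform\<close>

lemma continuous_eval: "continuous_on A (\<lambda>w. w t)" for A :: "(real \<Rightarrow> 'a::topological_space) set"
  by (rule continuous_on_subset[OF continuous_on_product_coordinates]) simp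

text \<open>The topology on functions is that of pointwise convergence, and each condition defining
  the set is closed in at most two evaluations.\<close>

lemma closed_mod_set:
  assumes "closed S" shows "closed (mod_set k0 S)"
proof -
  have "closed {w. w t \<in> S}" for t :: real
    using closed_vimage[OF assms continuous_eval] by (simp add: vimage_def)
  moreover have "closed {w :: real \<Rightarrow> 'a. w t = w s}" for s t
    by (intro closed_Collect_eq continuous_eval)
  moreover have "closed {w :: real \<Rightarrow> 'a. norm (w t) \<le> c}" for t c
    by (intro closed_Collect_le continuous_intros continuous_eval)
  moreover have "closed {w :: real \<Rightarrow> 'a. dist (w t) (w s) \<le> c}" for s t c
    by (intro closed_Collect_le continuous_intros continuous_eval)
  ultimately show ?thesis unfolding mod_set_def
    by (intro closed_Collect_conj closed_Collect_all closed_Collect_imp open_Collect_const) auto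
qed

lemma compact_mod_set:
  fixes S :: "'a::{real_normed_vector, heine_borel} set"
  assumes "closed S" shows "compact (mod_set k0 S)"
proof -
  \<comment> \<open>The exponent is the smallest level that is at least \<open>k0\<close> and whose
    interval reaches \<open>t\<close>. For \<open>t \<le> 0\<close> the ceiling is sent to 0, and
    the value is the one at time 0.\<close>
  define B :: "real \<Rightarrow> real" where "B = (\<lambda>t. 4^(max k0 (nat \<lceil>t\<rceil>)) + 19)"
  have "compactin (product_topology (\<lambda>_. euclidean) UNIV) (PiE UNIV (\<lambda>t::real. cball (0::'a) (B t)))"
    by (subst compactin_PiE) auto
  then have "compact (PiE UNIV (\<lambda>t::real. cball (0::'a) (B t)))" by (simp add: euclidean_product_topology)
  moreover have "mod_set k0 S \<subseteq> PiE UNIV (\<lambda>t::real. cball (0::'a) (B t))"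
  proof
    fix w assume w: "w \<in> mod_set k0 S"
    have "norm (w t) \<le> B t" for t
    proof (cases "t \<le> 0")
      case True
      then have "nat \<lceil>t\<rceil> = 0" by simp
      then show ?thesis using mod_setD(2)[OF w True] mod_setD(4)[OF w, of "max k0 0" 0] True by (simp add: B_def)
    next
      case False
      have "t \<le> real (max k0 (nat \<lceil>t\<rceil>))" 
        by (rule order_trans[OF real_nat_ceiling_ge]) (simp only: of_nat_le_iff max.cobounded2)
      then show ?thesis using mod_setD(4)[OF w, of "max k0 (nat \<lceil>t\<rceil>)" t] False by (simp add: B_def)
    qed
    then show "w \<in> PiE UNIV (\<lambda>t::real. cball (0::'a) (B t))" by auto
  qed
  ultimately show ?thesis using closed_mod_set[OF assms] by (metis closed_Int_compact inf.absorb1)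
qed

text \<open>On the equicontinuous set, pointwise convergence is as strong as locally uniform
  convergence, so Tychonoff compactness carries over.\<close>
lemma compactin_luc_mod_set:
  assumes "closed S" shows "compactin (luc_topology (CPaths S)) (mod_set k0 S)"
proof -
  let ?K = "mod_set k0 S" and ?Q = "CPaths S"
  \<comment> \<open>\<open>luc_topology\<close> is given by a subbase, so continuity of the identity
    need only be tested on the generating sets; the image of the compact set is then
    compact.\<close>
  have "continuous_map (top_of_set ?K) (luc_topology ?Q) id"
    unfolding luc_topology_def continuous_on_generated_topo_iff
  proof (intro conjI allI impI)
    fix U assume "U \<in> {{v \<in> ?Q. \<forall>t\<in>{0..T}. dist (v t) (u t) < r} | u T r. u \<in> ?Q \<and> T > 0 \<and> r > 0}"
    then obtain u T r where U: "U = {v \<in> ?Q. \<forall>t\<in>{0..T}. dist (v t) (u t) < r}" and u: "u \<in> ?Q" "T > 0" "r > 0" by blast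
    show "openin (top_of_set ?K) (id -` U \<inter> topspace (top_of_set ?K))"
    proof (subst openin_subopen, intro ballI)
      fix w assume "w \<in> id -` U \<inter> topspace (top_of_set ?K)"
      then have wK: "w \<in> ?K" and wU: "w \<in> U" by auto
      have "continuous_on {0..T} (\<lambda>t. dist (w t) (u t))"
        using u(1) wU unfolding U CPaths_def
        by (intro continuous_intros) (auto intro: continuous_on_subset)
      \<comment> \<open>The distance from \<open>w\<close> to the centre \<open>u\<close> attains
        its maximum \<rho> on \<open>{0..T}\<close>, which leaves a gap
        \<open>r - \<rho> > 0\<close>. One third of it is the allowance for each of the three
        comparisons made through the dyadic floor of \<open>t\<close>.\<close>
      then have "\<exists>x\<in>{0..T}. \<forall>y\<in>{0..T}. dist (w y) (u y) \<le> dist (w x) (u x)"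
        using u(2) by (intro continuous_attains_sup) auto
      then obtain t0 where t0: "t0 \<in> {0..T}" "\<And>t. t \<in> {0..T} \<Longrightarrow> dist (w t) (u t) \<le> dist (w t0) (u t0)"
        by blast
      define \<rho> where "\<rho> = dist (w t0) (u t0)"
      define e where "e = (r - \<rho>) / 3"
      have "\<rho> < r" using wU t0(1) unfolding U \<rho>_def by blast
      then have e: "e > 0" by (simp add: e_def)
      obtain m where m: "k0 \<le> m" "T \<le> real m" "39 * (19/20)^m < e"
        by (rule small_level[OF e, of k0 T])
      \<comment> \<open>\<open>V\<close> constrains finitely many times only, so it is open for
        pointwise convergence.\<close>
      define V where "V = (\<Inter>i\<in>{..m * 2^m}. {v :: real \<Rightarrow> real \<times> real. dist (v (real i / 2^m)) (w (real i / 2^m)) < e})"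
      have "open V" unfolding V_def
        by (intro open_INT ballI open_Collect_less continuous_intros continuous_eval) auto
      have "V \<inter> ?K \<subseteq> U"
      proof
        fix v assume v: "v \<in> V \<inter> ?K"
        have "dist (v t) (u t) < r" if t: "t \<in> {0..T}" for t
        proof -
          let ?g = "real (dyad m t) / 2^m"
          have tm: "0 \<le> t" "t \<le> real m" using t m by auto
          have g: "0 \<le> ?g" "?g \<le> t" "\<bar>t - ?g\<bar> \<le> 1 / 2^m"
            using dyad_div[OF tm(1), of m] by auto
          have 1: "dist (v ?g) (w ?g) < e" using v dyad_le[OF tm order_refl] by (auto simp: V_def)
          have 2: "dist (v t) (v ?g) < e"
            using mod_setD(3)[of v k0 S m t ?g] v g tm m by auto
          have 3: "dist (w t) (w ?g) < e"
            using mod_setD(3)[OF wK, of m t ?g] g tm m by auto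
          have 4: "dist (w t) (u t) \<le> \<rho>" using t0(2)[OF t] by (simp add: \<rho>_def)
          have "dist (v t) (u t) \<le> dist (v t) (v ?g) + (dist (v ?g) (w ?g) + (dist (w ?g) (w t) + dist (w t) (u t)))"
            by (meson add_left_mono dist_triangle order_trans)
          also have "\<dots> < e + (e + (e + \<rho>))" using 1 2 3 4 by (simp add: dist_commute)
          also have "\<dots> = r" by (simp add: e_def field_simps)
          finally show ?thesis .
        qed
        then show "v \<in> U" using v mod_set_subset unfolding U by blast
      qed
      moreover have "w \<in> V" using e by (simp add: V_def)
      moreover have "openin (top_of_set ?K) (V \<inter> ?K)"
        using \<open>open V\<close> by (metis inf_commute openin_open_Int)
      ultimately show "\<exists>T. openin (top_of_set ?K) T \<and> w \<in> T \<and> T \<subseteq> id -` U \<inter> topspace (top_of_set ?K)"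
        using wK by (intro exI[of _ "V \<inter> ?K"]) auto
    qed
  next
    show "id ` topspace (top_of_set ?K) \<subseteq> \<Union> {{v \<in> ?Q. \<forall>t\<in>{0..T}. dist (v t) (u t) < r} | u T r. u \<in> ?Q \<and> T > 0 \<and> r > 0}"
    proof
      fix w assume "w \<in> id ` topspace (top_of_set ?K)"
      then have w: "w \<in> ?Q" using mod_set_subset by auto
      then have "w \<in> {v \<in> ?Q. \<forall>t\<in>{0..1}. dist (v t) (w t) < 1}" by simp
      with w show "w \<in> \<Union> {{v \<in> ?Q. \<forall>t\<in>{0..T}. dist (v t) (u t) < r} | u T r. u \<in> ?Q \<and> T > 0 \<and> r > 0}"
        using zero_less_one by blast
    qed
  qed
  moreover have "compactin (top_of_set ?K) ?K"
    using compact_mod_set[OF assms, of k0] by (simp add: compactin_subtopology)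
  ultimately have "compactin (luc_topology ?Q) (id ` ?K)" by (intro image_compactin)
  then show ?thesis by simp
qed

text \<open>Markov's inequality bounds the failure of each dyadic constraint at level
  \<open>k\<close> by \<open>C * ((1/2)^k * \<rho>^k)\<close>; the \<open>k * 2^k + 1\<close>
  indices absorb \<open>(1/2)^k\<close> and leave a summable series. The level \<open>k0\<close>
  depends on \<open>C\<close> and \<eta> only, so one compact set serves every index
  \<open>i\<close>.\<close>

lemma Kolmogorov_tightness:
  fixes P :: "'i \<Rightarrow> 'a measure" and X :: "real \<Rightarrow> 'a \<Rightarrow> real \<times> real"
  assumes S: "closed S" and prob: "\<And>i. i \<in> I \<Longrightarrow> prob_space (P i)"
    and meas: "\<And>i t. i \<in> I \<Longrightarrow> X t \<in> borel_measurable (P i)"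
    and path: "\<And>i \<omega>. i \<in> I \<Longrightarrow> \<omega> \<in> space (P i) \<Longrightarrow> (\<lambda>t. X t \<omega>) \<in> CPaths S"
    and mom: "\<And>i t. i \<in> I \<Longrightarrow> 0 \<le> t \<Longrightarrow> integrable (P i) (\<lambda>\<omega>. norm (X t \<omega>)^2) \<and> (\<integral>\<omega>. norm (X t \<omega>)^2 \<partial>P i) \<le> C"
    and inc: "\<And>i s t. i \<in> I \<Longrightarrow> 0 \<le> s \<Longrightarrow> s < t \<Longrightarrow> integrable (P i) (\<lambda>\<omega>. dist (X t \<omega>) (X s \<omega>)^4)
        \<and> (\<integral>\<omega>. dist (X t \<omega>) (X s \<omega>)^4 \<partial>P i) \<le> C * ((t - s) * sqrt (t - s))"
    and C: "0 \<le> C" and \<eta>: "\<eta> > 0"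
  shows "\<exists>K. K \<subseteq> CPaths S \<and> compactin (luc_topology (CPaths S)) K \<and>
    (\<forall>i\<in>I. measure (P i) {\<omega> \<in> space (P i). (\<lambda>t. X t \<omega>) \<in> K} \<ge> 1 - \<eta>)"
proof -
  \<comment> \<open>\<open>sqrt (1/2)\<close> is what the exponent 3/2 leaves per level beyond the
    factor \<open>1/2\<close>, and dividing by \<open>(19/20)^4\<close> is the price of Markov's
    inequality for fourth powers. The lower bound \<open>1/8\<close> on \<rho> lets the same rate
    cover the norm constraint, where the factor per level is
    \<open>1/16 \<le> 1/2 * \<rho>\<close>.\<close>
  define \<rho> :: real where "\<rho> = sqrt (1/2) / (19/20)^4"
  have sq: "sqrt (1/2) < 3/4" "1/2 < sqrt (1/2::real)"
    by (rule real_less_lsqrt real_less_rsqrt; simp add: power2_eq_square)+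
  have \<rho>: "1/8 \<le> \<rho>" "\<rho> < 1"
    using sq by (simp_all add: \<rho>_def power4_eq_xxxx)
  \<comment> \<open>Two families of events, with at most \<open>Suc k * 2^k\<close> indices
    each.\<close>
  define b where "b = (\<lambda>k. 2 * C * (real (Suc k) * \<rho>^k))"
  have "summable (\<lambda>k. of_nat (Suc k) * \<rho>^k)"
    using geometric_deriv_sums[of \<rho>] \<rho> by (auto simp: sums_iff)
  then have sum_b: "summable b" unfolding b_def by (intro summable_mult)
  obtain k0 where k0: "norm (\<Sum>i. b (i + k0)) < \<eta>" using suminf_exist_split[OF \<eta> sum_b] by blast
  have b0: "0 \<le> b k" for k unfolding b_def using C \<rho> by simp
  show ?thesis
  proof (intro exI[of _ "mod_set k0 S"] conjI ballI mod_set_subset compactin_luc_mod_set S)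
    fix i assume i: "i \<in> I"
    interpret prob_space "P i" by (rule prob[OF i])
    note [measurable] = meas[OF i]
    define E1 where "E1 = (\<lambda>k j. {\<omega> \<in> space (P i). \<not> norm (X (real j / 2^k) \<omega>) \<le> 4^k})"
    define E2 where "E2 = (\<lambda>k j. {\<omega> \<in> space (P i). \<not> dist (X (real (Suc j) / 2^k) \<omega>) (X (real j / 2^k) \<omega>) \<le> (19/20)^k})"
    define F where "F = (\<lambda>k. \<Union>j\<in>{..k * 2^k}. E1 k j \<union> E2 k j)"
    have [measurable]: "E1 k j \<in> sets (P i)" "E2 k j \<in> sets (P i)" for k j
      unfolding E1_def E2_def by measurable
    have F_sets [measurable]: "F k \<in> sets (P i)" for k unfolding F_def by measurable
    have m1: "measure (P i) (E1 k j) \<le> C * ((1/2)^k * \<rho>^k)" for k j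
    proof -
      let ?u = "\<lambda>\<omega>. norm (X (real j / 2^k) \<omega>)^2"
      have "measure (P i) (E1 k j) \<le> measure (P i) {\<omega> \<in> space (P i). ?u \<omega> \<ge> (4^k)^2}"
      proof (rule finite_measure_mono)
        show "E1 k j \<subseteq> {\<omega> \<in> space (P i). ?u \<omega> \<ge> (4^k)^2}"
          unfolding E1_def by (auto intro!: power_mono simp: not_le less_imp_le)
      qed measurable
      also have "\<dots> \<le> (\<integral>\<omega>. ?u \<omega> \<partial>P i) / (4^k)^2"
        by (rule integral_Markov_inequality_measure[where A = "{}"]) (use mom[OF i] in auto)
      also have "\<dots> \<le> C / (4^k)^2" using mom[OF i] by (intro divide_right_mono) auto
      also have "\<dots> = C * (1/16)^k" by (simp add: power2_eq_square power_mult_distrib[symmetric] power_one_over field_simps)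
      also have "\<dots> \<le> C * (1/2 * \<rho>)^k" using \<rho> C by (intro mult_left_mono power_mono) auto
      also have "\<dots> = C * ((1/2)^k * \<rho>^k)" by (simp only: power_mult_distrib)
      finally show ?thesis .
    qed
    have m2: "measure (P i) (E2 k j) \<le> C * ((1/2)^k * \<rho>^k)" for k j
    proof -
      let ?u = "\<lambda>\<omega>. dist (X (real (Suc j) / 2^k) \<omega>) (X (real j / 2^k) \<omega>)^4"
      have h: "real (Suc j) / 2^k - real j / 2^k = (1/2)^k" by (simp add: field_simps power_one_over)
      have st: "0 \<le> real j / 2^k" "real j / 2^k < real (Suc j) / 2^k" by (auto simp: divide_strict_right_mono)
      note I = inc[OF i st, unfolded h]
      have "measure (P i) (E2 k j) \<le> measure (P i) {\<omega> \<in> space (P i). ?u \<omega> \<ge> ((19/20)^k)^4}"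
      proof (rule finite_measure_mono)
        show "E2 k j \<subseteq> {\<omega> \<in> space (P i). ?u \<omega> \<ge> ((19/20)^k)^4}"
          unfolding E2_def by (auto intro!: power_mono simp: not_le less_imp_le)
      qed measurable
      also have "\<dots> \<le> (\<integral>\<omega>. ?u \<omega> \<partial>P i) / ((19/20)^k)^4"
        by (rule integral_Markov_inequality_measure[where A = "{}"]) (use I in auto)
      also have "\<dots> \<le> C * ((1/2)^k * sqrt ((1/2)^k)) / ((19/20)^k)^4" using I by (intro divide_right_mono) auto
      also have "\<dots> = C * ((1/2)^k * \<rho>^k)"
        unfolding \<rho>_def real_sqrt_power power_divide[of "sqrt (1/2)"] power_mult[symmetric] by (simp add: mult.commute)
      finally show ?thesis .
    qed
    have mF: "measure (P i) (F k) \<le> b k" for k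
    proof -
      have "measure (P i) (F k) \<le> (\<Sum>j\<in>{..k * 2^k}. measure (P i) (E1 k j \<union> E2 k j))"
        unfolding F_def by (intro finite_measure_subadditive_finite) auto
      also have "\<dots> \<le> (\<Sum>j\<in>{..k * 2^k}. 2 * (C * ((1/2)^k * \<rho>^k)))"
      proof (rule sum_mono)
        fix j
        have "measure (P i) (E1 k j \<union> E2 k j) \<le> measure (P i) (E1 k j) + measure (P i) (E2 k j)"
          by (rule measure_Un_le) measurable
        then show "measure (P i) (E1 k j \<union> E2 k j) \<le> 2 * (C * ((1/2)^k * \<rho>^k))"
          using m1[of k j] m2[of k j] by linarith
      qed
      also have "\<dots> = real (k * 2^k + 1) * (2 * (C * ((1/2)^k * \<rho>^k)))" by simp
      also have "\<dots> \<le> real (Suc k * 2^k) * (2 * (C * ((1/2)^k * \<rho>^k)))"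
      proof (rule mult_right_mono)
        have "k * 2^k + 1 \<le> Suc k * 2^k" by simp
        then show "real (k * 2^k + 1) \<le> real (Suc k * 2^k)" by (simp only: of_nat_le_iff)
      qed (use C \<rho> in simp)
      also have "\<dots> = b k" by (simp add: b_def power_one_over field_simps)
      finally show ?thesis .
    qed
    have sF: "summable (\<lambda>k. measure (P i) (F (k + k0)))"
      by (rule summable_comparison_test'[where g = "\<lambda>k. b (k + k0)"])
         (use mF sum_b in \<open>auto simp: summable_iff_shift\<close>)
    have "measure (P i) (\<Union>k. F (k + k0)) \<le> (\<Sum>k. measure (P i) (F (k + k0)))"
      by (rule finite_measure_subadditive_countably[OF _ sF]) auto
    also have "\<dots> \<le> (\<Sum>k. b (k + k0))"
      by (intro suminf_le mF sF) (use sum_b in \<open>simp add: summable_iff_shift\<close>)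
    also have "\<dots> \<le> \<eta>" using k0 by simp
    finally have bad: "measure (P i) (\<Union>k. F (k + k0)) \<le> \<eta>" .
    \<comment> \<open>Since the paths are continuous, membership is exactly the absence of all
      dyadic failures from level \<open>k0\<close> on, a countable condition; hence the event is
      measurable.\<close>
    have "{\<omega> \<in> space (P i). (\<lambda>t. X t \<omega>) \<in> mod_set k0 S} = space (P i) - (\<Union>k. F (k + k0))"
    proof -
      have "(\<lambda>t. X t \<omega>) \<in> mod_set k0 S \<longleftrightarrow> \<omega> \<notin> (\<Union>k. F (k + k0))" if \<omega>: "\<omega> \<in> space (P i)" for \<omega>
      proof -
        have "(\<exists>k. \<omega> \<in> F (k + k0)) \<longleftrightarrow> (\<exists>k\<ge>k0. \<omega> \<in> F k)"
          by (metis le_add2 le_add_diff_inverse2)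
        then show ?thesis
          unfolding mod_set_iff[OF path[OF i \<omega>]] dyad_good_def F_def E1_def E2_def using \<omega> by auto
      qed
      then show ?thesis by blast
    qed
    then have "measure (P i) {\<omega> \<in> space (P i). (\<lambda>t. X t \<omega>) \<in> mod_set k0 S} = 1 - measure (P i) (\<Union>k. F (k + k0))"
      by (simp add: prob_compl)
    then show "measure (P i) {\<omega> \<in> space (P i). (\<lambda>t. X t \<omega>) \<in> mod_set k0 S} \<ge> 1 - \<eta>" using bad by simp
  qed
qed

section \<open>Stationary solutions of the martingale problem\<close>

lemma space_coord_sigma [simp]: "space (coord_sigma n T) = Paths n"
  unfolding coord_sigma_def by (rule space_measure_of) auto

lemma sets_coord_sigma:
  "sets (coord_sigma n T) = sigma_sets (Paths n) {{\<omega> \<in> Paths n. \<omega> s l \<in> A} | s l A. s \<in> T \<and> A \<in> sets borel}"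
  unfolding coord_sigma_def by (rule sets_measure_of) auto

lemma coord_sigma_mono: "T \<subseteq> T' \<Longrightarrow> sets (coord_sigma n T) \<subseteq> sets (coord_sigma n T')"
  unfolding sets_coord_sigma by (rule sigma_sets_subseteq) blast

lemma measurable_coord: "s \<in> T \<Longrightarrow> (\<lambda>\<omega>. \<omega> s l) \<in> borel_measurable (coord_sigma n T)"
proof (rule measurableI)
  fix A :: "real set" assume "s \<in> T" "A \<in> sets borel"
  then have "{\<omega> \<in> Paths n. \<omega> s l \<in> A} \<in> sets (coord_sigma n T)"
    unfolding sets_coord_sigma by (intro sigma_sets.Basic) blast
  also have "{\<omega> \<in> Paths n. \<omega> s l \<in> A} = (\<lambda>\<omega>. \<omega> s l) -` A \<inter> space (coord_sigma n T)" by auto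
  finally show "(\<lambda>\<omega>. \<omega> s l) -` A \<inter> space (coord_sigma n T) \<in> sets (coord_sigma n T)" .
qed simp

lemma measurable_eval: "s \<in> T \<Longrightarrow> (\<lambda>\<omega>. \<omega> s) \<in> borel_measurable (coord_sigma n T)"
  by (intro measurable_coordinatewise_then_product measurable_coord)

lemma PathsD:
  assumes "\<omega> \<in> Paths n"
  shows "continuous_on UNIV \<omega>" "\<omega> t \<in> Estate n" "t \<le> 0 \<Longrightarrow> \<omega> t = \<omega> 0"
  using assms unfolding Paths_def by blast+

text \<open>Paths are constant on negative times, so an evaluation there agrees with the one at
  0.\<close>

lemma measurable_eval_PathSpace: "(\<lambda>\<omega>. \<omega> s) \<in> borel_measurable (PathSpace n)"
proof -
  have "(\<lambda>\<omega>. \<omega> (max 0 s)) \<in> borel_measurable (PathSpace n)" by (rule measurable_eval) simp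
  moreover have "\<omega> (max 0 s) = \<omega> s" if "\<omega> \<in> space (PathSpace n)" for \<omega>
    using that PathsD(3)[of \<omega> n s] by (cases "s \<le> 0") (auto simp: max_def)
  ultimately show ?thesis by (rule measurable_cong[THEN iffD1, rotated])
qed

section \<open>Joint measurability, Fubini and Fatou\<close>

text \<open>Rounding time down to a multiple of \<open>1 / real (Suc k)\<close> turns the map into a
  countable gluing of measurable ones; continuity in time identifies the limit.\<close>

lemma borel_measurable_Caratheodory:
  fixes h :: "real \<Rightarrow> 'a \<Rightarrow> real"
  assumes cont: "\<And>\<omega>. \<omega> \<in> space M \<Longrightarrow> continuous_on UNIV (\<lambda>r. h r \<omega>)"
    and meas: "\<And>r. h r \<in> borel_measurable M"
  shows "(\<lambda>(r, \<omega>). h r \<omega>) \<in> borel_measurable (lborel \<Otimes>\<^sub>M M)"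
proof -
  let ?g = "\<lambda>k z. h (real_of_int \<lfloor>real (Suc k) * fst z\<rfloor> / real (Suc k)) (snd z)"
  show ?thesis
  proof (rule borel_measurable_LIMSEQ_real[where u = ?g])
    fix k
    show "?g k \<in> borel_measurable (lborel \<Otimes>\<^sub>M M)"
    proof (rule measurable_compose_countable[where f = "\<lambda>i z. h (real_of_int i / real (Suc k)) (snd z)"])
      show "(\<lambda>z. h (real_of_int i / real (Suc k)) (snd z)) \<in> borel_measurable (lborel \<Otimes>\<^sub>M M)" for i
        by (rule measurable_compose[OF measurable_snd meas])
    qed measurable
  next
    fix z :: "real \<times> 'a" assume z: "z \<in> space (lborel \<Otimes>\<^sub>M M)"
    obtain r \<omega> where [simp]: "z = (r, \<omega>)" by (cases z)
    have "(\<lambda>k. real_of_int \<lfloor>real (Suc k) * r\<rfloor> / real (Suc k)) \<longlonglongrightarrow> r"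
    proof (rule real_tendsto_sandwich)
      show "\<forall>\<^sub>F k in sequentially. r - 1 / real (Suc k) \<le> real_of_int \<lfloor>real (Suc k) * r\<rfloor> / real (Suc k)"
      proof (rule always_eventually, rule allI)
        fix k
        have "r * real (Suc k) - 1 \<le> real_of_int \<lfloor>real (Suc k) * r\<rfloor>" by (simp only: mult.commute[of r]) linarith
        then show "r - 1 / real (Suc k) \<le> real_of_int \<lfloor>real (Suc k) * r\<rfloor> / real (Suc k)"
          by (simp add: le_divide_eq left_diff_distrib del: of_nat_Suc)
      qed
      show "\<forall>\<^sub>F k in sequentially. real_of_int \<lfloor>real (Suc k) * r\<rfloor> / real (Suc k) \<le> r"
      proof (rule always_eventually, rule allI)
        fix k
        have "real_of_int \<lfloor>real (Suc k) * r\<rfloor> \<le> r * real (Suc k)" by (simp only: mult.commute[of r]) linarith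
        then show "real_of_int \<lfloor>real (Suc k) * r\<rfloor> / real (Suc k) \<le> r"
          by (simp add: divide_le_eq del: of_nat_Suc)
      qed
      have "(\<lambda>k. r - 1 / real (Suc k)) \<longlonglongrightarrow> r - 0"
        by (intro tendsto_intros LIMSEQ_Suc[OF lim_const_over_n])
      then show "(\<lambda>k. r - 1 / real (Suc k)) \<longlonglongrightarrow> r" by simp
    qed simp
    moreover have "isCont (\<lambda>r. h r \<omega>) r"
      using cont[of \<omega>] z by (simp add: space_pair_measure continuous_on_eq_continuous_at)
    ultimately show "(\<lambda>k. ?g k z) \<longlonglongrightarrow> (case z of (r, \<omega>) \<Rightarrow> h r \<omega>)"
      by (auto intro: isCont_tendsto_compose)
  qed
qed

lemma (in prob_space) Fubini_time:
  fixes h :: "real \<Rightarrow> 'a \<Rightarrow> real"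
  assumes cont: "\<And>\<omega>. \<omega> \<in> space M \<Longrightarrow> continuous_on UNIV (\<lambda>r. h r \<omega>)"
    and meas: "\<And>r. h r \<in> borel_measurable M"
    and bdd: "\<And>r \<omega>. \<omega> \<in> space M \<Longrightarrow> \<bar>h r \<omega>\<bar> \<le> B"
  shows "integrable M (\<lambda>\<omega>. LINT r:{s..t}|lborel. h r \<omega>)"
    and "set_integrable lborel {s..t} (\<lambda>r. \<integral>\<omega>. h r \<omega> \<partial>M)"
    and "(\<integral>\<omega>. (LINT r:{s..t}|lborel. h r \<omega>) \<partial>M) = (LINT r:{s..t}|lborel. (\<integral>\<omega>. h r \<omega> \<partial>M))"
proof -
  interpret L: pair_sigma_finite lborel M ..
  note [measurable] = borel_measurable_Caratheodory[OF cont meas]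
  have int: "integrable (lborel \<Otimes>\<^sub>M M) (\<lambda>(r, \<omega>). indicator {s..t} r *\<^sub>R h r \<omega>)"
  proof (rule Bochner_Integration.integrable_bound[where f = "\<lambda>z. B * indicator ({s..t} \<times> space M) z"])
    have "emeasure (lborel \<Otimes>\<^sub>M M) ({s..t} \<times> space M) < \<infinity>"
      by (subst emeasure_pair_measure_Times) (auto simp: emeasure_space_1 emeasure_lborel_Icc_eq)
    then show "integrable (lborel \<Otimes>\<^sub>M M) (\<lambda>z. B * indicator ({s..t} \<times> space M) z)"
      by (intro integrable_mult_right integrable_real_indicator) auto
    show "AE z in lborel \<Otimes>\<^sub>M M. norm (case z of (r, \<omega>) \<Rightarrow> indicator {s..t} r *\<^sub>R h r \<omega>)
         \<le> norm (B * indicator ({s..t} \<times> space M) z)"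
    proof (rule AE_I2)
      fix z :: "real \<times> 'a" assume "z \<in> space (lborel \<Otimes>\<^sub>M M)"
      then obtain r \<omega> where z: "z = (r, \<omega>)" "\<omega> \<in> space M" by (auto simp: space_pair_measure)
      then show "norm (case z of (r, \<omega>) \<Rightarrow> indicator {s..t} r *\<^sub>R h r \<omega>)
         \<le> norm (B * indicator ({s..t} \<times> space M) z)"
        using bdd[of \<omega> r] by (auto simp: indicator_def abs_mult)
    qed
  qed measurable
  show "integrable M (\<lambda>\<omega>. LINT r:{s..t}|lborel. h r \<omega>)"
    using L.integrable_snd[OF int] by (simp add: set_lebesgue_integral_def)
  show "set_integrable lborel {s..t} (\<lambda>r. \<integral>\<omega>. h r \<omega> \<partial>M)"
    using L.integrable_fst[OF int] by (simp add: set_integrable_def)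
  show "(\<integral>\<omega>. (LINT r:{s..t}|lborel. h r \<omega>) \<partial>M) = (LINT r:{s..t}|lborel. (\<integral>\<omega>. h r \<omega> \<partial>M))"
    using L.Fubini_integral[OF int] by (simp add: set_lebesgue_integral_def)
qed

text \<open>Carries bounds that are uniform in the truncation level over to the untruncated
  quantity, integrability included.\<close>

lemma Fatou_integral_bound:
  fixes f :: "nat \<Rightarrow> 'a \<Rightarrow> real"
  assumes int: "\<And>k. integrable M (f k)" and nonneg: "\<And>k x. x \<in> space M \<Longrightarrow> 0 \<le> f k x"
    and lim: "\<And>x. x \<in> space M \<Longrightarrow> (\<lambda>k. f k x) \<longlonglongrightarrow> g x"
    and bound: "\<And>k. (\<integral>x. f k x \<partial>M) \<le> C"
  shows "integrable M g" "(\<integral>x. g x \<partial>M) \<le> C"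
proof -
  have meas [measurable]: "\<And>k. f k \<in> borel_measurable M" using int by auto
  have [measurable]: "g \<in> borel_measurable M" using lim by (rule borel_measurable_LIMSEQ_real) measurable
  have g: "0 \<le> g x" if "x \<in> space M" for x
    using LIMSEQ_le_const[OF lim[OF that]] nonneg[OF that] by blast
  have C: "0 \<le> C"
  proof -
    have "0 \<le> (\<integral>x. f 0 x \<partial>M)" by (intro Bochner_Integration.integral_nonneg nonneg)
    then show ?thesis using bound[of 0] by simp
  qed
  have "(\<integral>\<^sup>+x. ennreal (g x) \<partial>M) = (\<integral>\<^sup>+x. liminf (\<lambda>k. ennreal (f k x)) \<partial>M)"
    by (intro nn_integral_cong lim_imp_Liminf[symmetric] tendsto_ennrealI lim) auto
  also have "\<dots> \<le> liminf (\<lambda>k. \<integral>\<^sup>+x. ennreal (f k x) \<partial>M)" by (rule nn_integral_liminf) measurable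
  also have "\<dots> \<le> liminf (\<lambda>k::nat. ennreal C)"
  proof (intro Liminf_mono always_eventually allI)
    fix k
    have "(\<integral>\<^sup>+x. ennreal (f k x) \<partial>M) = ennreal (\<integral>x. f k x \<partial>M)"
      by (intro nn_integral_eq_integral int AE_I2 nonneg)
    also have "\<dots> \<le> ennreal C" by (intro ennreal_leI bound)
    finally show "(\<integral>\<^sup>+x. ennreal (f k x) \<partial>M) \<le> ennreal C" .
  qed
  also have "\<dots> = ennreal C" by (simp add: Liminf_const)
  finally have nn: "(\<integral>\<^sup>+x. ennreal (g x) \<partial>M) \<le> ennreal C" .
  show "integrable M g"
  proof (rule integrableI_nonneg)
    show "(\<integral>\<^sup>+x. ennreal (g x) \<partial>M) < \<infinity>" using le_less_trans[OF nn ennreal_less_top] by simp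
  qed (use g in auto)
  then have "ennreal (\<integral>x. g x \<partial>M) \<le> ennreal C"
    using nn g by (subst nn_integral_eq_integral[symmetric]) auto
  then show "(\<integral>x. g x \<partial>M) \<le> C" using C by simp
qed

section \<open>One quadratic form under one stationary law\<close>

text \<open>The generator enters the estimates through its action on functions of one form, and the
  formula assumed for that action is free of \<epsilon>. The constants defined in the locale depend
  neither on \<open>L\<close> nor on \<open>P\<close>, and this is what makes the bounds
  uniform.\<close>

locale radial_solution =
  fixes n :: nat and lam \<delta> c :: "nat \<Rightarrow> real" and a \<Lambda> :: real
    and L :: "((nat \<Rightarrow> real) \<Rightarrow> real) \<Rightarrow> (nat \<Rightarrow> real) \<Rightarrow> real"
    and P :: "(real \<Rightarrow> nat \<Rightarrow> real) measure"
  assumes lam: "\<And>l. l \<in> {1..2*n} \<Longrightarrow> 1 \<le> lam l \<and> lam l \<le> \<Lambda>"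
    and \<Lambda>: "0 \<le> \<Lambda>"
    and a_pos: "0 < a"
    and \<delta>: "\<And>l. l \<in> {1..2*n} \<Longrightarrow> -1 < \<delta> l \<and> \<delta> l \<le> 0"
    and c: "\<And>l. l \<in> {1..2*n} \<Longrightarrow> 0 < c l \<and> c l \<le> 1"
    and L: "\<And>\<phi> \<phi>' \<phi>'' x. (\<And>s. (\<phi> has_real_derivative \<phi>' s) (at s)) \<Longrightarrow>
        (\<And>s. (\<phi>' has_real_derivative \<phi>'' s) (at s)) \<Longrightarrow> x \<in> Estate n \<Longrightarrow>
        L (\<lambda>x. \<phi> (wsq n c x)) x = \<phi>' (wsq n c x) * wdrift n lam a \<delta> c x + \<phi>'' (wsq n c x) * wdiff n lam a \<delta> c x"
    and sol: "stationary_solution n L P"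
begin

abbreviation "q \<equiv> wsq n c"
abbreviation "D \<equiv> wdrift n lam a \<delta> c"
abbreviation "G \<equiv> wdiff n lam a \<delta> c"

definition "A0 = (\<Sum>l\<in>{1..2*n}. lam l * (a * (1 + \<delta> l) * c l))"
definition "g0 = 2 * a * \<Lambda>"

lemma coeff_nonneg:
  assumes "l \<in> {1..2*n}"
  shows "0 \<le> lam l" "0 \<le> 1 + \<delta> l" "0 \<le> c l"
  using lam[OF assms] \<delta>[OF assms] c[OF assms] a_pos by auto

lemma A0_nonneg: "0 \<le> A0"
  unfolding A0_def using a_pos by (intro sum_nonneg mult_nonneg_nonneg coeff_nonneg) simp_all

lemma g0_nonneg: "0 \<le> g0" using a_pos \<Lambda> by (simp add: g0_def)

lemma q_nonneg: "0 \<le> q x" using c by (intro wsq_nonneg) (auto intro: less_imp_le)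

lemma D_eq: "D x = A0 - 2 * (\<Sum>l\<in>{1..2*n}. lam l * (c l * (x l)^2))"
  unfolding wdrift_def A0_def sum_distrib_left sum_subtractf[symmetric]
  by (intro sum.cong) (auto simp: algebra_simps)

text \<open>\<open>lam l \<ge> 1\<close> makes the drift dissipative at rate 2, the source of all
  moment bounds.\<close>

lemma D_le: "D x \<le> A0 - 2 * q x"
proof -
  have "q x \<le> (\<Sum>l\<in>{1..2*n}. lam l * (c l * (x l)^2))"
    unfolding wsq_def
  proof (rule sum_mono)
    fix l assume l: "l \<in> {1..2*n}"
    have "1 * (c l * (x l)^2) \<le> lam l * (c l * (x l)^2)"
      using lam[OF l] c[OF l] by (intro mult_right_mono) auto
    then show "c l * (x l)^2 \<le> lam l * (c l * (x l)^2)" by simp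
  qed
  then show ?thesis by (simp add: D_eq)
qed

lemma D_abs: "\<bar>D x\<bar> \<le> A0 + 2 * \<Lambda> * q x"
proof -
  have "(\<Sum>l\<in>{1..2*n}. lam l * (c l * (x l)^2)) \<le> \<Lambda> * q x"
    unfolding wsq_def sum_distrib_left
    using lam by (intro sum_mono mult_right_mono mult_nonneg_nonneg coeff_nonneg) auto
  moreover have "0 \<le> (\<Sum>l\<in>{1..2*n}. lam l * (c l * (x l)^2))"
    by (intro sum_nonneg mult_nonneg_nonneg coeff_nonneg zero_le_power2)
  ultimately show ?thesis using A0_nonneg unfolding D_eq by linarith
qed

lemma G_nonneg: "0 \<le> G x"
  unfolding wdiff_def
  using a_pos by (intro sum_nonneg mult_nonneg_nonneg coeff_nonneg zero_le_power2) simp_all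

text \<open>From \<open>c l \<le> 1\<close> follows \<open>(c l)^2 \<le> c l\<close>. The growth of
  \<open>G\<close> is thus only linear in \<open>q\<close>, which is why each moment is controlled
  by the one below it.\<close>

lemma G_le: "G x \<le> g0 * q x"
  unfolding wdiff_def wsq_def sum_distrib_left
proof (rule sum_mono)
  fix l assume l: "l \<in> {1..2*n}"
  have 1: "lam l * (1 + \<delta> l) \<le> \<Lambda> * 1" using lam[OF l] \<delta>[OF l] by (intro mult_mono) auto
  have 2: "(c l)^2 \<le> c l" using c[OF l] by (simp add: power2_eq_square mult_left_le)
  have "lam l * (1 + \<delta> l) * (c l)^2 \<le> \<Lambda> * 1 * c l"
    using \<Lambda> by (intro mult_mono[OF 1 2]) auto
  then have "(2 * a * (x l)^2) * (lam l * (1 + \<delta> l) * (c l)^2) \<le> (2 * a * (x l)^2) * (\<Lambda> * 1 * c l)"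
    using a_pos by (intro mult_left_mono) auto
  then show "2 * a * lam l * (1 + \<delta> l) * (c l)^2 * (x l)^2 \<le> g0 * (c l * (x l)^2)"
    by (simp add: g0_def algebra_simps)
qed

lemma prob_P: "prob_space P" and sets_P: "sets P = sets (PathSpace n)"
  using sol unfolding stationary_solution_def solves_MP_def by blast+

sublocale prob_space P by (rule prob_P)

lemma space_P: "space P = Paths n" using sets_eq_imp_space_eq[OF sets_P] by simp

lemma measurable_eval_P: "(\<lambda>\<omega>. \<omega> s) \<in> borel_measurable P"
  using measurable_eval_PathSpace[of s n] by (simp only: measurable_cong_sets[OF sets_P refl])

lemma borel_continuous: "continuous_on UNIV h \<Longrightarrow> (\<lambda>\<omega>. h (\<omega> s)) \<in> borel_measurable P" for h :: "(nat \<Rightarrow> real) \<Rightarrow> real"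
  by (rule measurable_compose[OF measurable_eval_P borel_measurable_continuous_onI])

lemma stationary:
  fixes h :: "(nat \<Rightarrow> real) \<Rightarrow> real"
  assumes "continuous_on UNIV h" "t \<ge> 0"
  shows "(\<integral>\<omega>. h (\<omega> t) \<partial>P) = (\<integral>\<omega>. h (\<omega> 0) \<partial>P)"
    and "integrable P (\<lambda>\<omega>. h (\<omega> t)) \<longleftrightarrow> integrable P (\<lambda>\<omega>. h (\<omega> 0))"
proof -
  have [measurable]: "h \<in> borel_measurable borel" by (rule borel_measurable_continuous_onI[OF assms(1)])
  have d: "distr P borel (\<lambda>\<omega>. \<omega> t) = distr P borel (\<lambda>\<omega>. \<omega> 0)"
    using sol assms(2) unfolding stationary_solution_def by blast
  show "(\<integral>\<omega>. h (\<omega> t) \<partial>P) = (\<integral>\<omega>. h (\<omega> 0) \<partial>P)"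
    using d integral_distr[OF measurable_eval_P[of t], of h] integral_distr[OF measurable_eval_P[of 0], of h] by simp
  show "integrable P (\<lambda>\<omega>. h (\<omega> t)) \<longleftrightarrow> integrable P (\<lambda>\<omega>. h (\<omega> 0))"
    using d integrable_distr_eq[OF measurable_eval_P[of t], of h] integrable_distr_eq[OF measurable_eval_P[of 0], of h] by simp
qed

lemma path_continuous:
  fixes h :: "(nat \<Rightarrow> real) \<Rightarrow> real"
  assumes "\<omega> \<in> Paths n" "continuous_on UNIV h"
  shows "continuous_on A (\<lambda>r. h (\<omega> r))"
proof -
  have "continuous_on UNIV \<omega>" using assms(1) by (rule PathsD)
  from continuous_on_compose2[OF assms(2) this] have "continuous_on UNIV (\<lambda>r. h (\<omega> r))" by simp
  then show ?thesis by (rule continuous_on_subset) simp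
qed

lemma bounded_integrable:
  fixes f :: "(real \<Rightarrow> nat \<Rightarrow> real) \<Rightarrow> real"
  assumes "f \<in> borel_measurable P" "\<And>\<omega>. \<omega> \<in> Paths n \<Longrightarrow> \<bar>f \<omega>\<bar> \<le> B"
  shows "integrable P f"
  by (rule integrable_const_bound[where B = B]) (use assms in \<open>auto simp: space_P intro!: AE_I2\<close>)

text \<open>The martingale property is stated against events of the past. It says that the increment
  of \<open>mart_fun\<close> has conditional expectation zero, and so allows any bounded factor
  \<open>Y\<close> measurable up to time \<open>s\<close>. Since \<open>\<phi>'\<close> and
  \<open>\<phi>''\<close> vanish beyond \<open>R\<close>, the generator term \<open>A\<close> is
  bounded and Fubini applies.\<close>

lemma dynkin:
  assumes \<phi>: "\<And>s. (\<phi> has_real_derivative \<phi>' s) (at s)"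
    and \<phi>': "\<And>s. (\<phi>' has_real_derivative \<phi>'' s) (at s)"
    and \<phi>'': "continuous_on UNIV \<phi>''"
    and supp: "\<And>s. s \<ge> R \<Longrightarrow> \<phi> s = K \<and> \<phi>' s = 0 \<and> \<phi>'' s = 0"
    and st: "0 \<le> s" "s \<le> t"
    and Y: "Y \<in> borel_measurable (coord_sigma n {0..s})"
    and Yb: "\<And>\<omega>. \<omega> \<in> Paths n \<Longrightarrow> \<bar>Y \<omega>\<bar> \<le> B"
  defines "A \<equiv> (\<lambda>x. \<phi>' (q x) * D x + \<phi>'' (q x) * G x)"
  shows "set_integrable lborel {s..t} (\<lambda>r. \<integral>\<omega>. Y \<omega> * A (\<omega> r) \<partial>P)"
    and "(\<integral>\<omega>. Y \<omega> * (\<phi> (q (\<omega> t)) - \<phi> (q (\<omega> s))) \<partial>P) = (LINT r:{s..t}|lborel. (\<integral>\<omega>. Y \<omega> * A (\<omega> r) \<partial>P))"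
proof -
  have c0: "continuous_on UNIV \<phi>" by (rule DERIV_continuous_on[OF \<phi>])
  have c1: "continuous_on UNIV \<phi>'" by (rule DERIV_continuous_on[OF \<phi>'])
  have cA: "continuous_on UNIV A"
    unfolding A_def
    by (intro continuous_intros continuous_on_wsq continuous_on_wdrift continuous_on_wdiff
        continuous_on_compose2[OF c1 continuous_on_wsq] continuous_on_compose2[OF \<phi>'' continuous_on_wsq]) auto
  have c\<phi>: "continuous_on UNIV (\<lambda>x. \<phi> (q x))"
    by (rule continuous_on_compose2[OF c0 continuous_on_wsq]) auto
  obtain M0 where M0: "\<And>s. 0 \<le> s \<Longrightarrow> \<bar>\<phi> s\<bar> \<le> M0" "0 \<le> M0"
  proof -
    have "bounded (\<phi> ` {0..R})"
      by (intro compact_imp_bounded compact_continuous_image continuous_on_subset[OF c0]) auto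
    then obtain m where "\<forall>s\<in>{0..R}. \<bar>\<phi> s\<bar> \<le> m" by (auto simp: bounded_iff)
    then show ?thesis using supp by (intro that[of "max \<bar>m\<bar> \<bar>K\<bar>"]) (smt (verit) atLeastAtMost_iff)+
  qed
  obtain M1 where M1: "\<And>s. 0 \<le> s \<Longrightarrow> s \<le> R \<Longrightarrow> \<bar>\<phi>' s\<bar> \<le> M1" "0 \<le> M1"
  proof -
    have "bounded (\<phi>' ` {0..R})"
      by (intro compact_imp_bounded compact_continuous_image continuous_on_subset[OF c1]) auto
    then obtain m where "\<forall>s\<in>{0..R}. \<bar>\<phi>' s\<bar> \<le> m" by (auto simp: bounded_iff)
    then show ?thesis by (intro that[of "\<bar>m\<bar>"]) force+
  qed
  obtain M2 where M2: "\<And>s. 0 \<le> s \<Longrightarrow> s \<le> R \<Longrightarrow> \<bar>\<phi>'' s\<bar> \<le> M2" "0 \<le> M2"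
  proof -
    have "bounded (\<phi>'' ` {0..R})"
      by (intro compact_imp_bounded compact_continuous_image continuous_on_subset[OF \<phi>'']) auto
    then obtain m where "\<forall>s\<in>{0..R}. \<bar>\<phi>'' s\<bar> \<le> m" by (auto simp: bounded_iff)
    then show ?thesis by (intro that[of "\<bar>m\<bar>"]) force+
  qed
  define MA where "MA = M1 * (A0 + 2 * \<Lambda> * \<bar>R\<bar>) + M2 * (g0 * \<bar>R\<bar>)"
  have MA0: "0 \<le> MA" unfolding MA_def using M1(2) M2(2) A0_nonneg \<Lambda> g0_nonneg by auto
  have MA: "\<bar>A x\<bar> \<le> MA" for x
  proof (cases "q x \<le> R")
    case True
    have q: "0 \<le> q x" "q x \<le> \<bar>R\<bar>" using q_nonneg True by auto
    have "\<bar>D x\<bar> \<le> A0 + 2 * \<Lambda> * \<bar>R\<bar>"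
      using D_abs[of x] mult_left_mono[OF q(2), of "2 * \<Lambda>"] \<Lambda> by simp
    moreover have "\<bar>G x\<bar> \<le> g0 * \<bar>R\<bar>"
      using G_le[of x] G_nonneg[of x] mult_left_mono[OF q(2) g0_nonneg] by simp
    ultimately show ?thesis
      unfolding A_def MA_def using M1 M2 q(1) True
      by (intro order_trans[OF abs_triangle_ineq]) (auto simp: abs_mult intro!: add_mono mult_mono)
  next
    case False
    then show ?thesis using supp[of "q x"] MA0 by (simp add: A_def)
  qed
  have sub: "subalgebra P (coord_sigma n {0..s})"
    unfolding subalgebra_def using coord_sigma_mono[of "{0..s}" "{0..}" n] by (simp add: space_P sets_P)
  interpret F: finite_measure_subalgebra P "coord_sigma n {0..s}" by unfold_locales (rule sub)
  have YP: "Y \<in> borel_measurable P" by (rule measurable_from_subalg[OF sub Y])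
  have B0: "0 \<le> B"
    using Yb not_empty abs_ge_zero order_trans unfolding space_P by blast
  \<comment> \<open>Subtracting the terminal value \<open>K\<close> gives compact support and leaves
    the derivatives unchanged.\<close>
  define f where "f = (\<lambda>x. \<phi> (q x) - K)"
  have "testfun n f" unfolding f_def
    by (rule testfun_radial[where \<phi> = "\<lambda>s. \<phi> s - K" and \<phi>' = \<phi>' and \<phi>'' = \<phi>'' and R = R])
       (use \<phi> \<phi>' \<phi>'' supp c in \<open>auto intro!: derivative_eq_intros\<close>)
  moreover have "0 \<le> t" using st by simp
  ultimately have int: "integrable P (mart_fun L f t)" "integrable P (mart_fun L f s)"
    and mart: "\<And>E. E \<in> sets (coord_sigma n {0..s}) \<Longrightarrow>
      set_lebesgue_integral P E (mart_fun L f t) = set_lebesgue_integral P E (mart_fun L f s)"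
    using sol st unfolding stationary_solution_def solves_MP_def by blast+
  define N where "N = (\<lambda>\<omega>. mart_fun L f t \<omega> - mart_fun L f s \<omega>)"
  have intN: "integrable P N" unfolding N_def using int by simp
  have Lf: "L f x = A x" if "x \<in> Estate n" for x
    unfolding f_def A_def
    by (rule L[where \<phi> = "\<lambda>s. \<phi> s - K"]) (use \<phi> \<phi>' that in \<open>auto intro!: derivative_eq_intros\<close>)
  have N: "N \<omega> = \<phi> (q (\<omega> t)) - \<phi> (q (\<omega> s)) - (LINT r:{s..t}|lborel. A (\<omega> r))" if \<omega>: "\<omega> \<in> Paths n" for \<omega>
  proof -
    have LA: "(\<lambda>r. L f (\<omega> r)) = (\<lambda>r. A (\<omega> r))" using PathsD(2)[OF \<omega>] Lf by auto
    have "interval_lebesgue_integrable lborel 0 (ereal t) (\<lambda>r. A (\<omega> r))"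
      using interval_integrable_continuous_on[OF \<open>0 \<le> t\<close> path_continuous[OF \<omega> cA]] by (simp add: zero_ereal_def)
    then have "(LBINT r=0..ereal s. A (\<omega> r)) + (LBINT r=ereal s..ereal t. A (\<omega> r)) = (LBINT r=0..ereal t. A (\<omega> r))"
      using st by (intro interval_integral_sum) (simp add: min_def max_def zero_ereal_def)
    then show ?thesis
      using interval_integral_Icc[OF st(2), of "\<lambda>r. A (\<omega> r)"]
      unfolding N_def mart_fun_def LA by (simp add: f_def)
  qed
  have setN: "set_lebesgue_integral P E N = set_lebesgue_integral P E (\<lambda>_. 0)" if E: "E \<in> sets (coord_sigma n {0..s})" for E
  proof -
    have "E \<in> sets P" using E sub by (auto simp: subalgebra_def)
    then have "set_integrable P E (mart_fun L f t)" "set_integrable P E (mart_fun L f s)"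
      unfolding set_integrable_def using int by (auto intro!: integrable_mult_indicator simp del: real_scaleR_def)
    then have "set_lebesgue_integral P E N = 0"
      unfolding N_def using mart[OF E] by (simp add: set_integral_diff)
    then show ?thesis by (simp add: set_lebesgue_integral_def)
  qed
  have "AE x in P. real_cond_exp P (coord_sigma n {0..s}) N x = 0"
    by (rule F.real_cond_exp_charact[OF setN intN]) auto
  then have "(\<integral>\<omega>. Y \<omega> * real_cond_exp P (coord_sigma n {0..s}) N \<omega> \<partial>P) = 0"
    by (intro integral_eq_zero_AE) auto
  moreover have "integrable P (\<lambda>\<omega>. Y \<omega> * N \<omega>)"
  proof (rule Bochner_Integration.integrable_bound[OF integrable_mult_right[OF intN, of B]])
    show "AE x in P. norm (Y x * N x) \<le> norm (B * N x)"
      using Yb B0 by (intro AE_I2) (auto simp: space_P abs_mult intro!: mult_right_mono)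
  qed (use YP intN in measurable)
  ultimately have zero: "(\<integral>\<omega>. Y \<omega> * N \<omega> \<partial>P) = 0"
    using F.real_cond_exp_intg(2)[OF _ Y, of N] intN by auto
  have contY: "continuous_on UNIV (\<lambda>r. Y \<omega> * A (\<omega> r))" if "\<omega> \<in> space P" for \<omega>
    using that path_continuous[OF _ cA] by (intro continuous_intros) (auto simp: space_P)
  have measY: "(\<lambda>\<omega>. Y \<omega> * A (\<omega> r)) \<in> borel_measurable P" for r
    by (intro borel_measurable_times YP borel_continuous cA)
  have bddY: "\<bar>Y \<omega> * A (\<omega> r)\<bar> \<le> B * MA" if "\<omega> \<in> space P" for r \<omega>
    using Yb[of \<omega>] MA[of "\<omega> r"] that B0 by (auto simp: abs_mult space_P intro!: mult_mono)
  note Fub = Fubini_time[OF contY measY bddY, of s t]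
  show "set_integrable lborel {s..t} (\<lambda>r. \<integral>\<omega>. Y \<omega> * A (\<omega> r) \<partial>P)" by (rule Fub(2))
  have int1: "integrable P (\<lambda>\<omega>. Y \<omega> * (\<phi> (q (\<omega> t)) - \<phi> (q (\<omega> s))))"
  proof (rule bounded_integrable)
    show "(\<lambda>\<omega>. Y \<omega> * (\<phi> (q (\<omega> t)) - \<phi> (q (\<omega> s)))) \<in> borel_measurable P"
      by (intro borel_measurable_times borel_measurable_diff YP borel_continuous[OF c\<phi>])
    show "\<bar>Y \<omega> * (\<phi> (q (\<omega> t)) - \<phi> (q (\<omega> s)))\<bar> \<le> B * (M0 + M0)" if "\<omega> \<in> Paths n" for \<omega>
      unfolding abs_mult using that Yb B0 M0 q_nonneg
      by (intro mult_mono order_trans[OF abs_triangle_ineq4] add_mono) auto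
  qed
  have "0 = (\<integral>\<omega>. Y \<omega> * (\<phi> (q (\<omega> t)) - \<phi> (q (\<omega> s))) - (LINT r:{s..t}|lborel. Y \<omega> * A (\<omega> r)) \<partial>P)"
    unfolding zero[symmetric]
    by (intro Bochner_Integration.integral_cong refl) (simp add: N space_P right_diff_distrib set_integral_mult_right)
  also have "\<dots> = (\<integral>\<omega>. Y \<omega> * (\<phi> (q (\<omega> t)) - \<phi> (q (\<omega> s))) \<partial>P) - (\<integral>\<omega>. (LINT r:{s..t}|lborel. Y \<omega> * A (\<omega> r)) \<partial>P)"
    by (rule Bochner_Integration.integral_diff[OF int1 Fub(1)])
  finally show "(\<integral>\<omega>. Y \<omega> * (\<phi> (q (\<omega> t)) - \<phi> (q (\<omega> s))) \<partial>P) = (LINT r:{s..t}|lborel. (\<integral>\<omega>. Y \<omega> * A (\<omega> r) \<partial>P))"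
    using Fub(3) by simp
qed

section \<open>Stationary moments of the quadratic form\<close>

text \<open>The generator applied to \<open>trunc_id R (q x)^k\<close>. The subtractions of naturals
  in the exponents are harmless: the factors \<open>real k\<close> and \<open>real (k - 1)\<close>
  vanish where the subtraction is cut off at 0.\<close>

definition "pgen R k x = (real k * trunc_id R (q x)^(k - 1) * trunc_id' R (q x)) * D x
    + (real k * real (k - 1) * trunc_id R (q x)^(k - 2) * trunc_id' R (q x)^2
       + real k * trunc_id R (q x)^(k - 1) * trunc_id'' R (q x)) * G x"

lemma continuous_trunc_q:
  "R > 0 \<Longrightarrow> continuous_on UNIV (\<lambda>x. trunc_id R (q x))"
  "R > 0 \<Longrightarrow> continuous_on UNIV (\<lambda>x. trunc_id' R (q x))"
  "R > 0 \<Longrightarrow> continuous_on UNIV (\<lambda>x. trunc_id'' R (q x))"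
  unfolding trunc_id_def trunc_id'_def trunc_id''_def
  by (intro continuous_intros continuous_on_wsq; simp)+

lemma continuous_pgen: "R > 0 \<Longrightarrow> continuous_on UNIV (pgen R k)"
  unfolding pgen_def
  by (intro continuous_intros continuous_trunc_q continuous_on_wdrift continuous_on_wdiff)

text \<open>A crude bound for fixed \<open>R\<close>, needed for integrability; it does not enter
  the final constants.\<close>

definition "pgenB R k = (real k * R^(k - 1) * 1) * (A0 + 2 * \<Lambda> * R)
    + (real k * real (k - 1) * R^(k - 2) * 1 + real k * R^(k - 1) * (2 / R)) * (g0 * R)"

lemma pgen_bounded:
  assumes R: "R > 0"
  shows "\<bar>pgen R k x\<bar> \<le> pgenB R k"
proof (cases "q x \<le> R")
  case True
  have q: "0 \<le> q x" "q x \<le> R" using q_nonneg True by auto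
  note b = trunc_id_bounds[OF R q(1)]
  have D: "\<bar>D x\<bar> \<le> A0 + 2 * \<Lambda> * R"
    using D_abs[of x] mult_left_mono[OF q(2), of "2 * \<Lambda>"] \<Lambda> by simp
  have G: "\<bar>G x\<bar> \<le> g0 * R"
    using G_le[of x] G_nonneg[of x] mult_left_mono[OF q(2) g0_nonneg] by simp
  have pk: "trunc_id R (q x)^j \<le> R^j" for j using b by (intro power_mono)
  have p1: "trunc_id' R (q x)^2 \<le> 1" using b by (intro power_le_one)
  have 1: "\<bar>real k * trunc_id R (q x)^(k - 1) * trunc_id' R (q x)\<bar> \<le> real k * R^(k - 1) * 1"
    unfolding abs_mult using b pk R by (intro mult_mono) (auto simp: power_abs)
  have 2: "\<bar>real k * real (k - 1) * trunc_id R (q x)^(k - 2) * trunc_id' R (q x)^2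
       + real k * trunc_id R (q x)^(k - 1) * trunc_id'' R (q x)\<bar>
    \<le> real k * real (k - 1) * R^(k - 2) * 1 + real k * R^(k - 1) * (2 / R)"
    unfolding abs_mult using b pk p1 R
    by (intro order_trans[OF abs_triangle_ineq] add_mono; simp only: abs_mult; intro mult_mono) (auto simp: power_abs)
  show ?thesis
    unfolding pgen_def pgenB_def
  proof (rule order_trans[OF abs_triangle_ineq], rule add_mono)
    show "\<bar>real k * trunc_id R (q x)^(k - 1) * trunc_id' R (q x) * D x\<bar> \<le> real k * R^(k - 1) * 1 * (A0 + 2 * \<Lambda> * R)"
      unfolding abs_mult[of _ "D x"] using R by (intro mult_mono[OF 1 D]) auto
    show "\<bar>(real k * real (k - 1) * trunc_id R (q x)^(k - 2) * trunc_id' R (q x)^2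
       + real k * trunc_id R (q x)^(k - 1) * trunc_id'' R (q x)) * G x\<bar>
       \<le> (real k * real (k - 1) * R^(k - 2) * 1 + real k * R^(k - 1) * (2 / R)) * (g0 * R)"
      unfolding abs_mult[of _ "G x"] using R by (intro mult_mono[OF 2 G]) auto
  qed
next
  case False
  then show ?thesis using R A0_nonneg \<Lambda> g0_nonneg
    by (simp add: pgen_def pgenB_def trunc_id'_ge trunc_id''_ge)
qed

lemma dynkin_power:
  assumes R: "R > 0" and st: "0 \<le> s" "s \<le> t"
    and Y: "Y \<in> borel_measurable (coord_sigma n {0..s})"
    and Yb: "\<And>\<omega>. \<omega> \<in> Paths n \<Longrightarrow> \<bar>Y \<omega>\<bar> \<le> B"
  shows "set_integrable lborel {s..t} (\<lambda>r. \<integral>\<omega>. Y \<omega> * pgen R k (\<omega> r) \<partial>P)"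
    and "(\<integral>\<omega>. Y \<omega> * (trunc_id R (q (\<omega> t))^k - trunc_id R (q (\<omega> s))^k) \<partial>P)
       = (LINT r:{s..t}|lborel. (\<integral>\<omega>. Y \<omega> * pgen R k (\<omega> r) \<partial>P))"
proof -
  let ?\<phi>' = "\<lambda>s. real k * trunc_id R s^(k - 1) * trunc_id' R s"
  let ?\<phi>'' = "\<lambda>s. real k * real (k - 1) * trunc_id R s^(k - 2) * trunc_id' R s^2
       + real k * trunc_id R s^(k - 1) * trunc_id'' R s"
  have 1: "((\<lambda>s. trunc_id R s^k) has_real_derivative ?\<phi>' s) (at s)" for s
    by (rule DERIV_cong[OF DERIV_power[OF DERIV_trunc_id[OF R]]]) simp
  have 2: "(?\<phi>' has_real_derivative ?\<phi>'' s) (at s)" for s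
    by (rule DERIV_cong[OF DERIV_mult[OF DERIV_cmult[OF DERIV_power[OF DERIV_trunc_id[OF R]]] DERIV_trunc_id'[OF R]]])
       (simp add: power2_eq_square numeral_2_eq_2)
  have 3: "continuous_on UNIV ?\<phi>''"
    unfolding trunc_id_def trunc_id'_def trunc_id''_def using R by (intro continuous_intros) auto
  have 4: "trunc_id R s^k = (R / 3)^k \<and> ?\<phi>' s = 0 \<and> ?\<phi>'' s = 0" if "s \<ge> R" for s
    using that R by (simp add: trunc_id_ge trunc_id'_ge trunc_id''_ge)
  note dynkin[OF 1 2 3 4 st Y Yb, folded pgen_def]
  then show "set_integrable lborel {s..t} (\<lambda>r. \<integral>\<omega>. Y \<omega> * pgen R k (\<omega> r) \<partial>P)"
    and "(\<integral>\<omega>. Y \<omega> * (trunc_id R (q (\<omega> t))^k - trunc_id R (q (\<omega> s))^k) \<partial>P)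
       = (LINT r:{s..t}|lborel. (\<integral>\<omega>. Y \<omega> * pgen R k (\<omega> r) \<partial>P))" by blast+
qed

text \<open>With \<open>Y = 1\<close> on the time interval \<open>{0..1}\<close>, stationarity makes
  the left side of Dynkin's formula vanish and the time integrand constant.\<close>

lemma stationary_pgen:
  assumes "R > 0"
  shows "(\<integral>\<omega>. pgen R k (\<omega> 0) \<partial>P) = 0"
proof -
  have "continuous_on UNIV (\<lambda>x. trunc_id R (q x)^k)"
    by (intro continuous_intros continuous_trunc_q assms)
  then have cont: "(\<integral>\<omega>. trunc_id R (q (\<omega> 1))^k \<partial>P) = (\<integral>\<omega>. trunc_id R (q (\<omega> 0))^k \<partial>P)"
    by (rule stationary) simp
  have int: "integrable P (\<lambda>\<omega>. trunc_id R (q (\<omega> r))^k)" for r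
  proof (rule bounded_integrable)
    show "(\<lambda>\<omega>. trunc_id R (q (\<omega> r))^k) \<in> borel_measurable P"
      by (rule borel_continuous) fact
    show "\<bar>trunc_id R (q (\<omega> r))^k\<bar> \<le> R^k" for \<omega>
      using trunc_id_bounds[OF assms q_nonneg] by (auto simp: power_abs intro!: power_mono)
  qed
  have "0 = (\<integral>\<omega>. 1 * (trunc_id R (q (\<omega> 1))^k - trunc_id R (q (\<omega> 0))^k) \<partial>P)"
    using cont by (simp add: Bochner_Integration.integral_diff[OF int int])
  also have "\<dots> = (LINT r:{0..1::real}|lborel. (\<integral>\<omega>. 1 * pgen R k (\<omega> r) \<partial>P))"
    by (rule dynkin_power(2)[where B = 1]) (use assms in auto)
  also have "\<dots> = (LINT r:{0..1::real}|lborel. (\<integral>\<omega>. pgen R k (\<omega> 0) \<partial>P))"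
    unfolding set_lebesgue_integral_def mult_1
    by (intro Bochner_Integration.integral_cong refl)
       (auto simp: indicator_def intro!: stationary(1)[OF continuous_pgen[OF assms]])
  also have "\<dots> = (\<integral>\<omega>. pgen R k (\<omega> 0) \<partial>P)"
    by (simp add: set_lebesgue_integral_def)
  finally show ?thesis by simp
qed

text \<open>In equilibrium the dissipation, \<open>2 * q^Suc k\<close>, is balanced in mean by at
  most \<open>(A0 + real k * g0) * q^k\<close>; the quotient is the step of this recursion.\<close>

primrec mom :: "nat \<Rightarrow> real" where
  "mom 0 = 1"
| "mom (Suc k) = (A0 + real k * g0) / 2 * mom k"

lemma mom_nonneg: "0 \<le> mom k"
  using A0_nonneg g0_nonneg by (induction k) auto

lemma continuous_q_power: "continuous_on UNIV (\<lambda>x. q x ^ k)"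
  by (intro continuous_intros continuous_on_wsq)

text \<open>Concavity of the truncation makes the term with \<open>trunc_id''\<close> nonpositive,
  so it is dropped. The dissipative term keeps its truncated form, because the integrability of
  \<open>q x ^ Suc k\<close> is not yet known where the bound is applied.\<close>

lemma pgen_le:
  assumes R: "R > 0"
  shows "pgen R (Suc k) x \<le> real (Suc k) * ((A0 + real k * g0) * q x ^ k - 2 * (trunc_id R (q x)^k * trunc_id' R (q x) * q x))"
proof -
  define p p1 p2 y where "p = trunc_id R (q x)" and "p1 = trunc_id' R (q x)" and "p2 = trunc_id'' R (q x)" and "y = q x"
  have b: "0 \<le> p" "p \<le> y" "0 \<le> p1" "p1 \<le> 1" "p2 \<le> 0" and y: "0 \<le> y"
    using trunc_id_bounds[OF R q_nonneg[of x]] q_nonneg[of x] by (auto simp: p_def p1_def p2_def y_def)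
  have 1: "p^k * p1 * D x \<le> A0 * y^k - 2 * (p^k * p1 * y)"
  proof -
    have "p^k * p1 * D x \<le> p^k * p1 * (A0 - 2 * y)"
      using D_le[of x] b by (intro mult_left_mono) (auto simp: y_def)
    moreover have "A0 * (p^k * p1) \<le> A0 * (y^k * 1)"
      using b y A0_nonneg by (intro mult_left_mono mult_mono power_mono) auto
    ultimately show ?thesis by (simp add: algebra_simps)
  qed
  have 2: "real k * p^(k - 1) * p1^2 * G x \<le> real k * g0 * y^k"
  proof (cases k)
    case (Suc j)
    have "p^j * p1^2 * G x \<le> y^j * 1 * (g0 * y)"
      using b y G_le[of x] G_nonneg[of x]
      by (intro mult_mono power_mono power_le_one) (auto simp: y_def)
    then have "real k * (p^j * p1^2 * G x) \<le> real k * (y^j * 1 * (g0 * y))" by (rule mult_left_mono) simp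
    then show ?thesis using Suc by (simp add: algebra_simps)
  qed simp
  have 3: "p^k * p2 * G x \<le> 0"
    using b G_nonneg[of x] by (intro mult_nonpos_nonneg mult_nonneg_nonpos) auto
  have "pgen R (Suc k) x = real (Suc k) * (p^k * p1 * D x + real k * p^(k - 1) * p1^2 * G x + p^k * p2 * G x)"
    unfolding pgen_def p_def p1_def p2_def by (simp add: numeral_2_eq_2 algebra_simps)
  also have "\<dots> \<le> real (Suc k) * ((A0 + real k * g0) * y^k - 2 * (p^k * p1 * y))"
  proof (rule mult_left_mono)
    show "p^k * p1 * D x + real k * p^(k - 1) * p1^2 * G x + p^k * p2 * G x \<le> (A0 + real k * g0) * y^k - 2 * (p^k * p1 * y)"
      using 1 2 3 by (simp only: distrib_right)
  qed simp
  finally show ?thesis by (simp add: p_def p1_def y_def)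
qed

text \<open>Induction on the power: the moment of order \<open>k\<close> bounds the truncated next
  one uniformly in \<open>R\<close>, and Fatou removes the truncation.\<close>

lemma moment_0: "integrable P (\<lambda>\<omega>. q (\<omega> 0)^k) \<and> (\<integral>\<omega>. q (\<omega> 0)^k \<partial>P) \<le> mom k"
proof (induction k)
  case 0
  then show ?case by (simp add: prob_space)
next
  case (Suc k)
  let ?f = "\<lambda>R \<omega>. trunc_id R (q (\<omega> 0))^k * trunc_id' R (q (\<omega> 0)) * q (\<omega> 0)"
  have bound: "integrable P (?f R)" "(\<integral>\<omega>. ?f R \<omega> \<partial>P) \<le> mom (Suc k)" if R: "R > 0" for R
  proof -
    have c: "continuous_on UNIV (\<lambda>x. trunc_id R (q x)^k * trunc_id' R (q x) * q x)"
      by (intro continuous_intros continuous_trunc_q R continuous_on_wsq)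
    have fb: "\<bar>?f R \<omega>\<bar> \<le> R^k * (1 * R)" for \<omega>
    proof (cases "q (\<omega> 0) \<le> R")
      case True
      then show ?thesis using trunc_id_bounds[OF R q_nonneg[of "\<omega> 0"]] R q_nonneg[of "\<omega> 0"]
        unfolding abs_mult mult.assoc power_abs by (intro mult_mono power_mono) auto
    next
      case False
      then show ?thesis using R by (simp add: trunc_id'_ge)
    qed
    show intf: "integrable P (?f R)"
      by (rule bounded_integrable[OF borel_continuous[OF c]]) (rule fb)
    have intp: "integrable P (\<lambda>\<omega>. pgen R (Suc k) (\<omega> 0))"
      by (rule bounded_integrable[OF borel_continuous[OF continuous_pgen[OF R]] pgen_bounded[OF R]])
    have "0 = (\<integral>\<omega>. pgen R (Suc k) (\<omega> 0) \<partial>P)" by (simp add: stationary_pgen[OF R])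
    also have "\<dots> \<le> (\<integral>\<omega>. real (Suc k) * ((A0 + real k * g0) * q (\<omega> 0) ^ k - 2 * ?f R \<omega>) \<partial>P)"
      by (intro integral_mono intp integrable_mult_right Bochner_Integration.integrable_diff intf pgen_le R)
         (use Suc in auto)
    also have "\<dots> = real (Suc k) * ((A0 + real k * g0) * (\<integral>\<omega>. q (\<omega> 0) ^ k \<partial>P) - 2 * (\<integral>\<omega>. ?f R \<omega> \<partial>P))"
      using Suc intf by (simp add: Bochner_Integration.integral_diff)
    finally have "2 * (\<integral>\<omega>. ?f R \<omega> \<partial>P) \<le> (A0 + real k * g0) * (\<integral>\<omega>. q (\<omega> 0) ^ k \<partial>P)"
      by (simp add: zero_le_mult_iff)
    also have "\<dots> \<le> (A0 + real k * g0) * mom k"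
      using Suc A0_nonneg g0_nonneg by (intro mult_left_mono) auto
    finally show "(\<integral>\<omega>. ?f R \<omega> \<partial>P) \<le> mom (Suc k)" by simp
  qed
  have lim: "(\<lambda>j. ?f (real (Suc j)) \<omega>) \<longlonglongrightarrow> q (\<omega> 0)^Suc k" for \<omega>
  proof -
    have "(\<lambda>j. ?f (real (Suc j)) \<omega>) \<longlonglongrightarrow> q (\<omega> 0)^k * 1 * q (\<omega> 0)"
      by (intro tendsto_intros trunc_id_tendsto)
    then show ?thesis by (simp add: mult.commute)
  qed
  have nonneg: "0 \<le> ?f (real (Suc j)) \<omega>" for j \<omega>
    using trunc_id_bounds[of "real (Suc j)", OF _ q_nonneg[of "\<omega> 0"]] q_nonneg[of "\<omega> 0"] by simp
  have "integrable P (?f (real (Suc j)))" "(\<integral>\<omega>. ?f (real (Suc j)) \<omega> \<partial>P) \<le> mom (Suc k)" for j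
    by (rule bound, simp)+
  then show ?case
    using Fatou_integral_bound[where M = P and f = "\<lambda>j. ?f (real (Suc j))" and g = "\<lambda>\<omega>. q (\<omega> 0)^Suc k"
      and C = "mom (Suc k)"] nonneg lim by blast
qed

lemma moment:
  assumes "t \<ge> 0"
  shows "integrable P (\<lambda>\<omega>. q (\<omega> t)^k)" "(\<integral>\<omega>. q (\<omega> t)^k \<partial>P) \<le> mom k"
  using moment_0[of k] stationary[OF continuous_q_power assms, of k] by auto

section \<open>Fourth moments of increments\<close>

text \<open>The generator applied to \<open>(trunc_id R (q x) - y)^4\<close> with \<open>y\<close>
  frozen.\<close>

definition "drift4 R x y = (let d = trunc_id R (q x) - y in
   4 * d^3 * (trunc_id' R (q x) * D x + trunc_id'' R (q x) * G x) + 12 * d^2 * (trunc_id' R (q x)^2 * G x))"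

lemma sum_1_4: "(\<Sum>k\<in>{1..4::nat}. f k) = f 1 + f 2 + f 3 + f 4" for f :: "nat \<Rightarrow> real"
  by (simp add: eval_nat_numeral)

lemma increment_identity:
  assumes R: "R > 0" and st: "0 \<le> s" "s \<le> t"
  defines "p \<equiv> \<lambda>x. trunc_id R (q x)"
  shows "(\<integral>\<omega>. (p (\<omega> t) - p (\<omega> s))^4 \<partial>P)
       = (LINT r:{s..t}|lborel. (\<integral>\<omega>. drift4 R (\<omega> r) (p (\<omega> s)) \<partial>P))"
proof -
  \<comment> \<open>Signed binomial coefficients of \<open>(p - y)^4\<close>. The power 0 has no
    increment and is left out; the weighted increments of the other powers add up to the whole
    fourth power because the expansion vanishes at \<open>p = y\<close>.\<close>
  define w where "w = (\<lambda>k::nat. [0, -4, 6, -4, 1 :: real] ! k)"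
  define Y where "Y = (\<lambda>k \<omega>. w k * p (\<omega> s)^(4 - k))" for k
  have pb: "\<bar>p x\<bar> \<le> R" for x using trunc_id_bounds[OF R q_nonneg[of x]] by (simp add: p_def)
  have cp: "continuous_on UNIV p" unfolding p_def by (rule continuous_trunc_q[OF R])
  have YF: "Y k \<in> borel_measurable (coord_sigma n {0..s})" for k
  proof -
    have "(\<lambda>\<omega>. p (\<omega> s)) \<in> borel_measurable (coord_sigma n {0..s})"
      by (rule measurable_compose[OF measurable_eval borel_measurable_continuous_onI[OF cp]]) (use st in auto)
    then show ?thesis unfolding Y_def by measurable
  qed
  have YP: "Y k \<in> borel_measurable P" for k
  proof -
    have [measurable]: "(\<lambda>\<omega>. p (\<omega> s)) \<in> borel_measurable P" by (rule borel_continuous[OF cp])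
    show ?thesis unfolding Y_def by measurable
  qed
  have Yb: "\<bar>Y k \<omega>\<bar> \<le> \<bar>w k\<bar> * R^(4 - k)" for k \<omega>
    unfolding Y_def abs_mult power_abs using pb by (intro mult_left_mono power_mono) auto
  note dyn = dynkin_power[OF R st YF Yb]
  have int1: "integrable P (\<lambda>\<omega>. Y k \<omega> * (p (\<omega> t)^k - p (\<omega> s)^k))" for k
  proof (rule bounded_integrable)
    have [measurable]: "(\<lambda>\<omega>. p (\<omega> r)) \<in> borel_measurable P" for r by (rule borel_continuous[OF cp])
    show "(\<lambda>\<omega>. Y k \<omega> * (p (\<omega> t)^k - p (\<omega> s)^k)) \<in> borel_measurable P"
      using YP[of k] by measurable
    show "\<bar>Y k \<omega> * (p (\<omega> t)^k - p (\<omega> s)^k)\<bar> \<le> (\<bar>w k\<bar> * R^(4 - k)) * (R^k + R^k)" for \<omega>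
      unfolding abs_mult using Yb[of k \<omega>] pb R
      by (intro mult_mono order_trans[OF abs_triangle_ineq4] add_mono) (auto simp: power_abs intro!: power_mono)
  qed
  have int2: "integrable P (\<lambda>\<omega>. Y k \<omega> * pgen R k (\<omega> r))" for k r
  proof (rule bounded_integrable)
    show "(\<lambda>\<omega>. Y k \<omega> * pgen R k (\<omega> r)) \<in> borel_measurable P"
      by (intro borel_measurable_times YP borel_continuous[OF continuous_pgen[OF R]])
    show "\<bar>Y k \<omega> * pgen R k (\<omega> r)\<bar> \<le> (\<bar>w k\<bar> * R^(4 - k)) * pgenB R k" for \<omega>
      unfolding abs_mult using Yb[of k \<omega>] pgen_bounded[OF R, of k "\<omega> r"] R by (intro mult_mono) auto
  qed
  have e1: "(\<Sum>k\<in>{1..4}. Y k \<omega> * (p (\<omega> t)^k - p (\<omega> s)^k)) = (p (\<omega> t) - p (\<omega> s))^4" for \<omega>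
    unfolding sum_1_4 Y_def w_def by (simp add: numeral_eq_Suc algebra_simps)
  have e2: "(\<Sum>k\<in>{1..4}. Y k \<omega> * pgen R k (\<omega> r)) = drift4 R (\<omega> r) (p (\<omega> s))" for \<omega> r
    unfolding sum_1_4 Y_def w_def pgen_def drift4_def p_def Let_def by (simp add: numeral_eq_Suc algebra_simps)
  have "(\<integral>\<omega>. (p (\<omega> t) - p (\<omega> s))^4 \<partial>P) = (\<Sum>k\<in>{1..4}. \<integral>\<omega>. Y k \<omega> * (p (\<omega> t)^k - p (\<omega> s)^k) \<partial>P)"
    unfolding e1[symmetric] by (rule Bochner_Integration.integral_sum[OF int1])
  also have "\<dots> = (\<Sum>k\<in>{1..4}. LINT r:{s..t}|lborel. (\<integral>\<omega>. Y k \<omega> * pgen R k (\<omega> r) \<partial>P))"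
    unfolding p_def by (simp only: dyn(2))
  also have "\<dots> = (LINT r:{s..t}|lborel. (\<Sum>k\<in>{1..4}. \<integral>\<omega>. Y k \<omega> * pgen R k (\<omega> r) \<partial>P))"
    using dyn(1) unfolding set_lebesgue_integral_def set_integrable_def scaleR_sum_right
    by (subst Bochner_Integration.integral_sum) auto
  also have "\<dots> = (LINT r:{s..t}|lborel. (\<integral>\<omega>. drift4 R (\<omega> r) (p (\<omega> s)) \<partial>P))"
    unfolding e2[symmetric] by (subst Bochner_Integration.integral_sum[OF int2]) simp
  finally show ?thesis .
qed

text \<open>\<open>HB\<close> is the growth constant of \<open>drift4\<close> after division by the
  squared increment, and \<open>CH\<close> bounds the mean of the square of that quotient.
  \<open>C1\<close> and \<open>incC\<close> are the outcomes of the two bootstrap passes, with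
  \<theta> equal to 1 and to \<open>sqrt (t - s)\<close>.\<close>

definition "HB = 4 * A0 + 6 * (2 * \<Lambda> + 2 * g0) + 6 * g0"
definition "CH = 3 * HB^2 * (1 + 2 * mom 4)"
definition "C1 = (2 * mom 4 + CH) / 2"
definition "incC = (C1 + CH) / 2"

lemma CH_nonneg: "0 \<le> CH" unfolding CH_def using mom_nonneg[of 4] by simp
lemma C1_nonneg: "0 \<le> C1" unfolding C1_def using mom_nonneg[of 4] CH_nonneg by simp
lemma incC_nonneg: "0 \<le> incC" unfolding incC_def using C1_nonneg CH_nonneg by simp

text \<open>Factoring out \<open>d^2\<close> leaves a quantity \<open>H\<close> of quadratic growth,
  and Young's inequality for \<open>d^2 * H\<close> gives back \<open>d^4\<close>, so that a bound
  already known for the increment can be reused. \<open>R \<ge> 1\<close> is there to make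
  \<open>2 / R \<le> 2\<close>.\<close>

lemma drift4_le:
  assumes R: "R \<ge> 1" and \<theta>: "\<theta> > 0"
  shows "drift4 R x (trunc_id R (q y)) \<le>
    ((trunc_id R (q x) - trunc_id R (q y))^4 / \<theta> + \<theta> * (3 * HB^2 * (1 + q x^4 + q y^4))) / 2"
proof -
  define d l m where "d = trunc_id R (q x) - trunc_id R (q y)"
    and "l = trunc_id' R (q x) * D x + trunc_id'' R (q x) * G x" and "m = trunc_id' R (q x)^2 * G x"
  define u v where "u = q x" and "v = q y"
  have R0: "R > 0" using R by simp
  have uv: "0 \<le> u" "0 \<le> v" using q_nonneg by (auto simp: u_def v_def)
  note bx = trunc_id_bounds[OF R0 q_nonneg[of x]] and b_y = trunc_id_bounds[OF R0 q_nonneg[of y]]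
  have d: "\<bar>d\<bar> \<le> u + v" using bx(1,2) b_y(1,2) uv unfolding d_def u_def v_def by linarith
  have G: "0 \<le> G x" "G x \<le> g0 * u" using G_nonneg G_le by (auto simp: u_def)
  have t2: "\<bar>trunc_id'' R (q x)\<bar> \<le> 2" 
  proof -
    have "2 / R \<le> 2" using R by (simp add: field_simps)
    then show ?thesis using bx(7) by linarith
  qed
  define e where "e = 2 * \<Lambda> + 2 * g0"
  have e: "0 \<le> e" unfolding e_def using \<Lambda> g0_nonneg by simp
  have l: "\<bar>l\<bar> \<le> A0 + e * u"
  proof -
    have "\<bar>trunc_id' R (q x) * D x\<bar> \<le> 1 * (A0 + 2 * \<Lambda> * u)"
      unfolding abs_mult using bx D_abs[of x] by (intro mult_mono) (auto simp: u_def)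
    moreover have "\<bar>trunc_id'' R (q x) * G x\<bar> \<le> 2 * (g0 * u)"
      unfolding abs_mult using t2 G by (intro mult_mono) auto
    ultimately show ?thesis unfolding l_def e_def by (simp add: algebra_simps)
  qed
  have m: "0 \<le> m" "m \<le> g0 * u"
  proof -
    show "0 \<le> m" using G by (simp add: m_def)
    have "m \<le> 1 * (g0 * u)" unfolding m_def using bx G by (intro mult_mono power_le_one) auto
    then show "m \<le> g0 * u" by simp
  qed
  define H where "H = 4 * \<bar>d\<bar> * \<bar>l\<bar> + 12 * m"
  have H0: "0 \<le> H" using m by (simp add: H_def)
  have "H \<le> 4 * ((u + v) * (A0 + e * u)) + 12 * (g0 * u)"
  proof -
    have "\<bar>d\<bar> * \<bar>l\<bar> \<le> (u + v) * (A0 + e * u)" using d l uv by (intro mult_mono) auto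
    then show ?thesis using m by (simp add: H_def)
  qed
  also have "\<dots> \<le> HB * (1 + u^2 + v^2)"
  proof -
    have "HB * (1 + u^2 + v^2) - (4 * ((u + v) * (A0 + e * u)) + 12 * (g0 * u)) =
      2 * A0 * ((u - 1)^2 + (v - 1)^2 + u^2 + v^2) + 2 * e * ((u - v)^2 + 3 + 2 * v^2) + 6 * g0 * ((u - 1)^2 + v^2)"
      unfolding HB_def e_def[symmetric] by (simp add: power2_eq_square algebra_simps)
    also have "\<dots> \<ge> 0" using A0_nonneg e g0_nonneg by simp
    finally show ?thesis by simp
  qed
  finally have "H^2 \<le> (HB * (1 + u^2 + v^2))^2" using H0 by (intro power_mono)
  also have "\<dots> \<le> 3 * HB^2 * (1 + u^4 + v^4)"
  proof -
    have "(1 + u^2 + v^2)^2 \<le> 3 * (1 + u^4 + v^4)"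
    proof -
      have "0 \<le> (u^2 - 1)^2 + (v^2 - 1)^2 + (u^2 - v^2)^2" by simp
      then show ?thesis by (simp add: power2_eq_square power4_eq_xxxx algebra_simps)
    qed
    then have "HB^2 * (1 + u^2 + v^2)^2 \<le> HB^2 * (3 * (1 + u^4 + v^4))" by (rule mult_left_mono) simp
    also have "\<dots> = 3 * HB^2 * (1 + u^4 + v^4)" by (simp only: mult_ac)
    finally show ?thesis by (simp only: power_mult_distrib)
  qed
  finally have H2: "H^2 \<le> 3 * HB^2 * (1 + u^4 + v^4)" .
  have "drift4 R x (trunc_id R (q y)) = 4 * d^3 * l + 12 * d^2 * m"
    by (simp add: drift4_def Let_def d_def l_def m_def)
  also have "\<dots> \<le> d^2 * H"
  proof -
    have "d * l \<le> \<bar>d\<bar> * \<bar>l\<bar>" by (metis abs_ge_self abs_mult)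
    then have "d^2 * (4 * (d * l)) \<le> d^2 * (4 * (\<bar>d\<bar> * \<bar>l\<bar>))" by (intro mult_left_mono) auto
    then show ?thesis by (simp add: H_def power2_eq_square power3_eq_cube algebra_simps)
  qed
  also have "\<dots> \<le> (d^4 / \<theta> + \<theta> * H^2) / 2"
  proof -
    have "0 \<le> (d^2 - \<theta> * H)^2 / \<theta>" using \<theta> by simp
    also have "\<dots> = d^4 / \<theta> + \<theta> * H^2 - 2 * (d^2 * H)"
      using \<theta> by (simp add: power2_eq_square power4_eq_xxxx field_simps)
    finally show ?thesis by simp
  qed
  also have "\<dots> \<le> (d^4 / \<theta> + \<theta> * (3 * HB^2 * (1 + u^4 + v^4))) / 2"
    using H2 \<theta> by (intro divide_right_mono add_left_mono mult_left_mono) auto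
  finally show ?thesis by (simp add: d_def u_def v_def)
qed

lemma trunc_increment_integrable:
  assumes "R > 0"
  shows "integrable P (\<lambda>\<omega>. (trunc_id R (q (\<omega> t)) - trunc_id R (q (\<omega> s)))^4)"
proof (rule bounded_integrable)
  have [measurable]: "(\<lambda>\<omega>. trunc_id R (q (\<omega> r))) \<in> borel_measurable P" for r
    by (rule borel_continuous[OF continuous_trunc_q(1)[OF assms]])
  show "(\<lambda>\<omega>. (trunc_id R (q (\<omega> t)) - trunc_id R (q (\<omega> s)))^4) \<in> borel_measurable P" by measurable
  show "\<bar>(trunc_id R (q (\<omega> t)) - trunc_id R (q (\<omega> s)))^4\<bar> \<le> R^4" for \<omega>
    using trunc_id_bounds[OF assms q_nonneg[of "\<omega> t"]] trunc_id_bounds[OF assms q_nonneg[of "\<omega> s"]]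
    unfolding power_abs by (intro power_mono) auto
qed

text \<open>Any a priori bound on the fourth moment up to time \<open>t\<close> can be fed back through
  Young's inequality with a free parameter \<open>\<theta>\<close>; doing this twice yields the exponent 3/2.\<close>
lemma increment_bootstrap:
  assumes R: "R \<ge> 1" and st: "0 \<le> s" "s \<le> t" and \<theta>: "\<theta> > 0" and K: "0 \<le> K"
    and prior: "\<And>r. s \<le> r \<Longrightarrow> r \<le> t \<Longrightarrow> (\<integral>\<omega>. (trunc_id R (q (\<omega> r)) - trunc_id R (q (\<omega> s)))^4 \<partial>P) \<le> K"
  shows "(\<integral>\<omega>. (trunc_id R (q (\<omega> t)) - trunc_id R (q (\<omega> s)))^4 \<partial>P) \<le> (t - s) * ((K / \<theta> + \<theta> * CH) / 2)"
proof -
  let ?p = "\<lambda>r \<omega>. trunc_id R (q (\<omega> r))"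
  have R0: "R > 0" using R by simp
  have bd: "(\<integral>\<omega>. drift4 R (\<omega> r) (?p s \<omega>) \<partial>P) \<le> (K / \<theta> + \<theta> * CH) / 2" if r: "s \<le> r" "r \<le> t" for r
  proof -
    let ?U = "\<lambda>\<omega>. ((?p r \<omega> - ?p s \<omega>)^4 / \<theta> + \<theta> * (3 * HB^2 * (1 + q (\<omega> r)^4 + q (\<omega> s)^4))) / 2"
    have r0: "0 \<le> r" using r st by simp
    note i = trunc_increment_integrable[OF R0, of r s] moment(1)[OF r0, of 4] moment(1)[OF st(1), of 4]
    \<comment> \<open>\<open>integral_mono'\<close> asks for integrability of the larger side only;
      nonnegativity of that side covers the case in which the other integral takes its default value
      0. The nonnegativity fact \<open>B0\<close> plays the same part for the time integral.\<close>
    have U0: "0 \<le> ?U \<omega>" for \<omega> using \<theta> q_nonneg by (simp add: power_even_eq)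
    have "(\<integral>\<omega>. drift4 R (\<omega> r) (?p s \<omega>) \<partial>P) \<le> (\<integral>\<omega>. ?U \<omega> \<partial>P)"
      by (rule integral_mono') (use i drift4_le[OF R \<theta>] U0 in auto)
    also have "\<dots> = ((\<integral>\<omega>. (?p r \<omega> - ?p s \<omega>)^4 \<partial>P) / \<theta>
        + \<theta> * (3 * HB^2 * (1 + (\<integral>\<omega>. q (\<omega> r)^4 \<partial>P) + (\<integral>\<omega>. q (\<omega> s)^4 \<partial>P)))) / 2"
      using i by (simp add: prob_space)
    also have "\<dots> \<le> (K / \<theta> + \<theta> * CH) / 2"
    proof -
      have "1 + (\<integral>\<omega>. q (\<omega> r)^4 \<partial>P) + (\<integral>\<omega>. q (\<omega> s)^4 \<partial>P) \<le> 1 + 2 * mom 4"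
        using moment(2)[OF r0, of 4] moment(2)[OF st(1), of 4] by simp
      then have "3 * HB^2 * (1 + (\<integral>\<omega>. q (\<omega> r)^4 \<partial>P) + (\<integral>\<omega>. q (\<omega> s)^4 \<partial>P)) \<le> CH"
        unfolding CH_def by (intro mult_left_mono) auto
      then show ?thesis
        using prior[OF r] \<theta> by (intro divide_right_mono add_mono mult_left_mono) auto
    qed
    finally show ?thesis .
  qed
  have B0: "0 \<le> (K / \<theta> + \<theta> * CH) / 2" using K \<theta> CH_nonneg by simp
  have "(\<integral>\<omega>. (?p t \<omega> - ?p s \<omega>)^4 \<partial>P) = (LINT r:{s..t}|lborel. (\<integral>\<omega>. drift4 R (\<omega> r) (?p s \<omega>) \<partial>P))"
    by (rule increment_identity[OF R0 st])
  also have "\<dots> \<le> (LINT r:{s..t}|lborel. (K / \<theta> + \<theta> * CH) / 2)"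
    unfolding set_lebesgue_integral_def
  proof (rule integral_mono')
    show "integrable lborel (\<lambda>r. indicat_real {s..t} r *\<^sub>R ((K / \<theta> + \<theta> * CH) / 2))"
      by (intro integrable_scaleR_left integrable_real_indicator) (auto simp: emeasure_lborel_Icc_eq)
  qed (use bd B0 in \<open>auto simp: indicator_def\<close>)
  also have "\<dots> = (t - s) * ((K / \<theta> + \<theta> * CH) / 2)"
    using st by (simp add: set_lebesgue_integral_def)
  finally show ?thesis .
qed

text \<open>From the bound by moments, the pass with \<theta> = 1 gives order \<open>t - s\<close>;
  with \<theta> = \<open>sqrt (t - s)\<close> both terms of Young's inequality are then of order
  \<open>sqrt (t - s)\<close>. The strict inequality \<open>s < t\<close> keeps this parameter
  positive.\<close>

lemma trunc_increment:
  assumes R: "R \<ge> 1" and st: "0 \<le> s" "s < t"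
  shows "(\<integral>\<omega>. (trunc_id R (q (\<omega> t)) - trunc_id R (q (\<omega> s)))^4 \<partial>P) \<le> incC * ((t - s) * sqrt (t - s))"
proof -
  let ?p = "\<lambda>r \<omega>. trunc_id R (q (\<omega> r))"
  have R0: "R > 0" using R by simp
  have 0: "(\<integral>\<omega>. (?p r \<omega> - ?p s \<omega>)^4 \<partial>P) \<le> 2 * mom 4" if r: "s \<le> r" for r
  proof -
    have r0: "0 \<le> r" using r st by simp
    have "(\<integral>\<omega>. (?p r \<omega> - ?p s \<omega>)^4 \<partial>P) \<le> (\<integral>\<omega>. q (\<omega> r)^4 + q (\<omega> s)^4 \<partial>P)"
    proof (rule integral_mono')
      fix \<omega>
      let ?m = "max (q (\<omega> r)) (q (\<omega> s))"
      have "\<bar>?p r \<omega> - ?p s \<omega>\<bar> \<le> ?m"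
        using trunc_id_bounds[OF R0 q_nonneg[of "\<omega> r"]] trunc_id_bounds[OF R0 q_nonneg[of "\<omega> s"]] by linarith
      then have "\<bar>?p r \<omega> - ?p s \<omega>\<bar>^4 \<le> ?m^4" by (intro power_mono) auto
      also have "\<dots> \<le> q (\<omega> r)^4 + q (\<omega> s)^4" by (simp add: max_def)
      finally show "(?p r \<omega> - ?p s \<omega>)^4 \<le> q (\<omega> r)^4 + q (\<omega> s)^4" by (simp add: power_even_abs_numeral)
    qed (use moment(1)[OF r0, of 4] moment(1)[OF st(1), of 4] in auto)
    also have "\<dots> \<le> 2 * mom 4"
      using moment[OF r0, of 4] moment[OF st(1), of 4] by simp
    finally show ?thesis .
  qed
  \<comment> \<open>The bound carries \<open>t - s\<close> instead of \<open>r - s\<close>, since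
    the second pass needs one constant for all intermediate times.\<close>
  have 1: "(\<integral>\<omega>. (?p r \<omega> - ?p s \<omega>)^4 \<partial>P) \<le> (t - s) * C1" if r: "s \<le> r" "r \<le> t" for r
  proof -
    have "(\<integral>\<omega>. (?p r \<omega> - ?p s \<omega>)^4 \<partial>P) \<le> (r - s) * ((2 * mom 4 / 1 + 1 * CH) / 2)"
      by (rule increment_bootstrap[OF R st(1) r(1)]) (use 0 mom_nonneg in auto)
    also have "\<dots> \<le> (t - s) * C1" unfolding C1_def[symmetric] using r C1_nonneg
      by (simp add: C1_def[symmetric] mult_right_mono)
    finally show ?thesis .
  qed
  have "(\<integral>\<omega>. (?p t \<omega> - ?p s \<omega>)^4 \<partial>P) \<le> (t - s) * (((t - s) * C1 / sqrt (t - s) + sqrt (t - s) * CH) / 2)"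
    by (rule increment_bootstrap[OF R st(1)]) (use 1 st C1_nonneg in auto)
  also have "(t - s) * C1 / sqrt (t - s) = sqrt (t - s) * C1"
    using st real_div_sqrt[of "t - s"] by (metis diff_ge_0_iff_ge less_imp_le times_divide_eq_left)
  finally show ?thesis by (simp add: incC_def field_simps)
qed

lemma increment:
  assumes st: "0 \<le> s" "s < t"
  shows "integrable P (\<lambda>\<omega>. (q (\<omega> t) - q (\<omega> s))^4)"
    "(\<integral>\<omega>. (q (\<omega> t) - q (\<omega> s))^4 \<partial>P) \<le> incC * ((t - s) * sqrt (t - s))"
proof -
  let ?f = "\<lambda>j \<omega>. (trunc_id (real (Suc j)) (q (\<omega> t)) - trunc_id (real (Suc j)) (q (\<omega> s)))^4"
  have 1: "integrable P (?f j)" for j by (rule trunc_increment_integrable) simp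
  have 2: "(\<integral>\<omega>. ?f j \<omega> \<partial>P) \<le> incC * ((t - s) * sqrt (t - s))" for j
    by (rule trunc_increment) (use st in auto)
  have 3: "(\<lambda>j. ?f j \<omega>) \<longlonglongrightarrow> (q (\<omega> t) - q (\<omega> s))^4" for \<omega>
    by (intro tendsto_intros trunc_id_tendsto)
  have 4: "0 \<le> ?f j \<omega>" for j \<omega> by (simp add: zero_le_even_power)
  show "integrable P (\<lambda>\<omega>. (q (\<omega> t) - q (\<omega> s))^4)"
    "(\<integral>\<omega>. (q (\<omega> t) - q (\<omega> s))^4 \<partial>P) \<le> incC * ((t - s) * sqrt (t - s))"
    using Fatou_integral_bound[where M = P and f = ?f and g = "\<lambda>\<omega>. (q (\<omega> t) - q (\<omega> s))^4"
      and C = "incC * ((t - s) * sqrt (t - s))", OF 1 4 3 2] by blast+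
qed

end

section \<open>Tightness\<close>

lemma sqnorm_wsq: "sqnorm n = wsq n (\<lambda>_. 1)" "sqnorm_m1 n lam = wsq n (\<lambda>l. 1 / lam l)"
  by (auto simp: sqnorm_def sqnorm_m1_def wsq_def)

lemma closed_Cone: "closed (Cone n lam)"
proof -
  have "Cone n lam = {z. 0 \<le> snd z} \<inter> {z. snd z \<le> fst z} \<inter> {z. fst z \<le> lam (2*n) * snd z}"
    by (auto simp: Cone_def)
  also have "closed \<dots>" by (intro closed_Int closed_Collect_le continuous_intros)
  finally show ?thesis .
qed

lemma lam_bounds:
  fixes lam :: "nat \<Rightarrow> real"
  assumes lam1: "lam 1 = 1"
    and lam_pair: "\<forall>i\<in>{1..n}. lam (2*i - 1) = lam (2*i)"
    and lam_incr: "\<forall>i\<in>{1..<n}. lam (2*i) < lam (2*i + 1)"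
    and l: "l \<in> {1..2*n}"
  shows "1 \<le> lam l" "lam l \<le> lam (2*n)"
proof -
  have incr: "lam i \<le> lam (Suc i)" if i: "1 \<le> i" "i < 2*n" for i
  proof (cases "even i")
    case True
    then obtain j where j: "i = 2 * j" by blast
    then have "lam (2*j) < lam (2*j + 1)" using i by (intro lam_incr[rule_format]) auto
    then show ?thesis by (simp add: j)
  next
    case False
    then obtain j where j: "i = 2 * j + 1" by (rule oddE)
    then have "lam (2 * Suc j - 1) = lam (2 * Suc j)" using i by (intro lam_pair[rule_format]) auto
    then show ?thesis by (simp add: j)
  qed
  have mono: "lam i \<le> lam j" if "i \<le> j" "1 \<le> i" "j \<le> 2*n" for i j
    using that(1,3)
  proof (induction j rule: dec_induct)
    case (step j)
    then show ?case using incr[of j] \<open>1 \<le> i\<close> by auto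
  qed simp
  show "1 \<le> lam l" using mono[of 1 l] l lam1 by simp
  show "lam l \<le> lam (2*n)" using mono[of l "2*n"] l by simp
qed

lemma sum_power4_le: "(x^2 + y^2)^2 \<le> 2 * (x^4 + y^4)" for x y :: real
proof -
  have "0 \<le> (x^2 - y^2)^2" by simp
  then show ?thesis by (simp add: power2_eq_square power4_eq_xxxx algebra_simps)
qed

theorem theorem4p1:
  fixes n :: nat and lam \<delta> :: "nat \<Rightarrow> real" and a \<kappa> :: real
    and b :: "(nat \<Rightarrow> real) \<Rightarrow> nat \<Rightarrow> real"
    and P :: "real \<Rightarrow> (real \<Rightarrow> nat \<Rightarrow> real) measure"
  assumes n4: "n \<ge> 4"
    and lam1: "lam 1 = 1"
    and lam_pair: "\<forall>i\<in>{1..n}. lam (2*i - 1) = lam (2*i)"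
    and lam_incr: "\<forall>i\<in>{1..<n}. lam (2*i) < lam (2*i + 1)"
    and a_pos: "a > 0"
    and \<delta>_range: "\<forall>l\<in>{1..2*n}. -1 < \<delta> l \<and> \<delta> l \<le> 0"
    and \<delta>_pair: "\<forall>i\<in>{1..n}. \<delta> (2*i) = \<delta> (2*i - 1)"
    and b_quad: "\<exists>Q :: nat \<Rightarrow> nat \<Rightarrow> nat \<Rightarrow> real. \<forall>x. \<forall>l\<in>{1..2*n}.
                   b x l = (\<Sum>j\<in>{1..2*n}. \<Sum>k\<in>{1..2*n}. Q l j k * x j * x k)"
    and b_div: "\<forall>x\<in>Estate n. divergence n b x = 0"
    and b_orth: "\<forall>x\<in>Estate n. inner0 n x (b x) = 0"
    and b_orth_m1: "\<forall>x\<in>Estate n. inner_m1 n lam x (b x) = 0"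
    and \<kappa>_range: "0 < \<kappa>" "\<kappa> \<le> 1"
    and P_sol: "\<forall>\<epsilon>>0. stationary_solution n (Lgen n lam a \<delta> b \<kappa> \<epsilon>) (P \<epsilon>)"
    and P_unique: "\<forall>\<epsilon>>0. \<forall>Q. stationary_solution n (Lgen n lam a \<delta> b \<kappa> \<epsilon>) Q \<longrightarrow> Q = P \<epsilon>"
  shows "\<forall>\<eta>>0. \<exists>K. K \<subseteq> CPaths (Cone n lam) \<and>
           compactin (luc_topology (CPaths (Cone n lam))) K \<and>
           (\<forall>\<epsilon>>0. measure (P \<epsilon>) {\<omega> \<in> space (P \<epsilon>). (\<lambda>t. Wmap n lam (\<omega> t)) \<in> K} \<ge> 1 - \<eta>)"
proof (intro allI impI)
  fix \<eta> :: real assume \<eta>: "\<eta> > 0"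
  note lb = lam_bounds[OF lam1 lam_pair lam_incr]
  have N: "1 \<le> lam (2*n)" using lb(1)[of "2*n"] n4 by simp
  have rs: "radial_solution n lam \<delta> c a (lam (2*n)) (Lgen n lam a \<delta> b \<kappa> \<epsilon>) (P \<epsilon>)"
    if \<epsilon>: "\<epsilon> > 0" and c: "c = (\<lambda>_. 1) \<or> c = (\<lambda>l. 1 / lam l)" for \<epsilon> c
  proof
    show "1 \<le> lam l \<and> lam l \<le> lam (2*n)" if "l \<in> {1..2*n}" for l using lb[OF that] by simp
    show "0 \<le> lam (2*n)" using N by simp
    show "0 < a" by (rule a_pos)
    show "-1 < \<delta> l \<and> \<delta> l \<le> 0" if "l \<in> {1..2*n}" for l using \<delta>_range that by blast
    show "0 < c l \<and> c l \<le> 1" if "l \<in> {1..2*n}" for l using c lb(1)[OF that] by auto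
    show "stationary_solution n (Lgen n lam a \<delta> b \<kappa> \<epsilon>) (P \<epsilon>)" using P_sol \<epsilon> by blast
    show "Lgen n lam a \<delta> b \<kappa> \<epsilon> (\<lambda>x. \<phi> (wsq n c x)) x =
        \<phi>' (wsq n c x) * wdrift n lam a \<delta> c x + \<phi>'' (wsq n c x) * wdiff n lam a \<delta> c x"
      if "\<And>s. (\<phi> has_real_derivative \<phi>' s) (at s)" "\<And>s. (\<phi>' has_real_derivative \<phi>'' s) (at s)" "x \<in> Estate n"
      for \<phi> \<phi>' \<phi>'' x
      by (rule Lgen_radial[where \<phi> = \<phi> and \<phi>' = \<phi>' and \<phi>'' = \<phi>'', OF that(1,2) c lam_pair])
         (use b_orth b_orth_m1 that(3) in blast)+
  qed
  let ?u = "wsq n (\<lambda>_. 1)" and ?v = "wsq n (\<lambda>l. 1 / lam l)"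
  note rsu = rs[of _ "\<lambda>_. 1", simplified] and rsv = rs[of _ "\<lambda>l. 1 / lam l", simplified]
  \<comment> \<open>The choice \<epsilon> = 1 only gives names to the constants. As they do not
    depend on the generator or the law, the same \<open>U.mom\<close>, \<open>V.mom\<close>,
    \<open>U.incC\<close> and \<open>V.incC\<close> appear below for every \<epsilon>.\<close>
  interpret U: radial_solution n lam \<delta> "\<lambda>_. 1" a "lam (2*n)" "Lgen n lam a \<delta> b \<kappa> 1" "P 1" by (rule rsu) simp
  interpret V: radial_solution n lam \<delta> "\<lambda>l. 1 / lam l" a "lam (2*n)" "Lgen n lam a \<delta> b \<kappa> 1" "P 1" by (rule rsv) simp
  \<comment> \<open>The second moments serve the norm bound. The factor 2 comes from
    \<open>sum_power4_le\<close>, which splits the fourth power of the Euclidean distance into the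
    two coordinates; the sum makes one constant do for both.\<close>
  define C where "C = (U.mom 2 + V.mom 2) + 2 * (U.incC + V.incC)"
  have nn: "0 \<le> U.mom 2 + V.mom 2" "0 \<le> 2 * (U.incC + V.incC)"
    using U.mom_nonneg[of 2] V.mom_nonneg[of 2] U.incC_nonneg V.incC_nonneg by auto
  have W: "Wmap n lam x = (?u x, ?v x)" for x by (simp add: Wmap_def sqnorm_wsq)
  have "\<exists>K. K \<subseteq> CPaths (Cone n lam) \<and> compactin (luc_topology (CPaths (Cone n lam))) K \<and>
    (\<forall>\<epsilon>\<in>{0<..}. measure (P \<epsilon>) {\<omega> \<in> space (P \<epsilon>). (\<lambda>t. Wmap n lam (\<omega> t)) \<in> K} \<ge> 1 - \<eta>)"
  proof (rule Kolmogorov_tightness[where X = "\<lambda>t \<omega>. Wmap n lam (\<omega> t)" and C = C])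
    fix \<epsilon> :: real assume "\<epsilon> \<in> {0<..}"
    then have \<epsilon>: "\<epsilon> > 0" by simp
    note ru = rsu[OF \<epsilon>] and rv = rsv[OF \<epsilon>]
    have mu [measurable]: "(\<lambda>\<omega>. ?u (\<omega> t)) \<in> borel_measurable (P \<epsilon>)" for t
      by (rule radial_solution.borel_continuous[OF ru continuous_on_wsq])
    have mv [measurable]: "(\<lambda>\<omega>. ?v (\<omega> t)) \<in> borel_measurable (P \<epsilon>)" for t
      by (rule radial_solution.borel_continuous[OF rv continuous_on_wsq])
    show "prob_space (P \<epsilon>)" by (rule radial_solution.prob_P[OF ru])
    show "(\<lambda>\<omega>. Wmap n lam (\<omega> t)) \<in> borel_measurable (P \<epsilon>)" for t unfolding W by measurable
    show "(\<lambda>t. Wmap n lam (\<omega> t)) \<in> CPaths (Cone n lam)" if "\<omega> \<in> space (P \<epsilon>)" for \<omega>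
    proof -
      have \<omega>: "\<omega> \<in> Paths n" using that radial_solution.space_P[OF ru] by simp
      have "continuous_on UNIV (\<lambda>t. Wmap n lam (\<omega> t))"
        unfolding W by (intro continuous_on_Pair U.path_continuous[OF \<omega>] continuous_on_wsq)
      moreover have "Wmap n lam x \<in> Cone n lam" for x
      proof -
        have "?v x \<le> ?u x" unfolding wsq_def
        proof (rule sum_mono)
          fix l assume "l \<in> {1..2*n}"
          from lb(1)[OF this] show "1 / lam l * (x l)^2 \<le> 1 * (x l)^2" by (intro mult_right_mono) auto
        qed
        moreover have "?u x \<le> lam (2*n) * ?v x" unfolding wsq_def sum_distrib_left mult.assoc[symmetric]
        proof (rule sum_mono)
          fix l assume "l \<in> {1..2*n}"
          from lb[OF this] show "1 * (x l)^2 \<le> lam (2*n) * (1 / lam l) * (x l)^2" by (intro mult_right_mono) auto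
        qed
        ultimately show ?thesis using V.q_nonneg[of x] by (simp add: W Cone_def)
      qed
      moreover have "Wmap n lam (\<omega> t) = Wmap n lam (\<omega> 0)" if "t \<le> 0" for t
        by (simp only: PathsD(3)[OF \<omega> that])
      ultimately show ?thesis unfolding CPaths_def by blast
    qed
    show "integrable (P \<epsilon>) (\<lambda>\<omega>. norm (Wmap n lam (\<omega> t))^2) \<and> (\<integral>\<omega>. norm (Wmap n lam (\<omega> t))^2 \<partial>P \<epsilon>) \<le> C"
      if t: "0 \<le> t" for t
    proof -
      have e: "norm (Wmap n lam (\<omega> t))^2 = ?u (\<omega> t)^2 + ?v (\<omega> t)^2" for \<omega> by (simp add: W norm_Pair)
      note Mu = radial_solution.moment[OF ru t, of 2] and Mv = radial_solution.moment[OF rv t, of 2]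
      show ?thesis unfolding e using Mu Mv nn(2) by (auto simp: C_def)
    qed
    show "integrable (P \<epsilon>) (\<lambda>\<omega>. dist (Wmap n lam (\<omega> t)) (Wmap n lam (\<omega> s))^4)
        \<and> (\<integral>\<omega>. dist (Wmap n lam (\<omega> t)) (Wmap n lam (\<omega> s))^4 \<partial>P \<epsilon>) \<le> C * ((t - s) * sqrt (t - s))"
      if st: "0 \<le> s" "s < t" for s t
    proof -
      let ?g = "\<lambda>\<omega>. 2 * ((?u (\<omega> t) - ?u (\<omega> s))^4 + (?v (\<omega> t) - ?v (\<omega> s))^4)"
      note Iu = radial_solution.increment[OF ru st] and Iv = radial_solution.increment[OF rv st]
      have le: "dist (Wmap n lam (\<omega> t)) (Wmap n lam (\<omega> s))^4 \<le> ?g \<omega>" for \<omega>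
      proof -
        have "dist (Wmap n lam (\<omega> t)) (Wmap n lam (\<omega> s))^4 = ((dist (Wmap n lam (\<omega> t)) (Wmap n lam (\<omega> s)))^2)^2" by simp
        also have "(dist (Wmap n lam (\<omega> t)) (Wmap n lam (\<omega> s)))^2 = (?u (\<omega> t) - ?u (\<omega> s))^2 + (?v (\<omega> t) - ?v (\<omega> s))^2"
          by (simp add: W dist_Pair_Pair dist_real_def)
        finally show ?thesis using sum_power4_le by simp
      qed
      have ig: "integrable (P \<epsilon>) ?g" using Iu(1) Iv(1) by simp
      have id: "integrable (P \<epsilon>) (\<lambda>\<omega>. dist (Wmap n lam (\<omega> t)) (Wmap n lam (\<omega> s))^4)"
      proof (rule Bochner_Integration.integrable_bound[OF ig])
        show "(\<lambda>\<omega>. dist (Wmap n lam (\<omega> t)) (Wmap n lam (\<omega> s))^4) \<in> borel_measurable (P \<epsilon>)"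
          unfolding W by measurable
        show "AE \<omega> in P \<epsilon>. norm (dist (Wmap n lam (\<omega> t)) (Wmap n lam (\<omega> s))^4) \<le> norm (?g \<omega>)"
        proof (rule AE_I2)
          fix \<omega>
          have "norm (dist (Wmap n lam (\<omega> t)) (Wmap n lam (\<omega> s))^4) = dist (Wmap n lam (\<omega> t)) (Wmap n lam (\<omega> s))^4" by simp
          also have "\<dots> \<le> ?g \<omega>" by (rule le)
          also have "\<dots> \<le> norm (?g \<omega>)" by simp
          finally show "norm (dist (Wmap n lam (\<omega> t)) (Wmap n lam (\<omega> s))^4) \<le> norm (?g \<omega>)" .
        qed
      qed
      have "(\<integral>\<omega>. dist (Wmap n lam (\<omega> t)) (Wmap n lam (\<omega> s))^4 \<partial>P \<epsilon>) \<le> (\<integral>\<omega>. ?g \<omega> \<partial>P \<epsilon>)"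
        by (intro integral_mono id ig le)
      also have "\<dots> \<le> 2 * (U.incC * ((t - s) * sqrt (t - s)) + V.incC * ((t - s) * sqrt (t - s)))"
        using Iu Iv by simp
      also have "\<dots> = 2 * (U.incC + V.incC) * ((t - s) * sqrt (t - s))" by (simp add: algebra_simps)
      also have "\<dots> \<le> C * ((t - s) * sqrt (t - s))"
        using nn st by (intro mult_right_mono) (auto simp: C_def)
      finally show ?thesis using id by blast
    qed
  qed (use nn \<eta> closed_Cone in \<open>auto simp: C_def\<close>)
  then show "\<exists>K. K \<subseteq> CPaths (Cone n lam) \<and> compactin (luc_topology (CPaths (Cone n lam))) K \<and>
    (\<forall>\<epsilon>>0. measure (P \<epsilon>) {\<omega> \<in> space (P \<epsilon>). (\<lambda>t. Wmap n lam (\<omega> t)) \<in> K} \<ge> 1 - \<eta>)"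
    by (simp only: Ball_def greaterThan_iff)
qed

end
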